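(* If $G$ is a Garside group with tame Garside element $\Delta$, then every solvable subgroup of $G$ is virtually a finitely generated abelian group.
   Context: An element $m\neq 1$ of a monoid $M$ is indivisible if $m=ab$ implies $a=1$ or $b=1$. For $m\in M$, $\|m\|$ is the supremum of the lengths of all expressions of $m$ as a product of indivisible elements. $M$ is atomic if it is generated by its indivisible elements and $\|m\|<\infty$ for all $m$. A Garside monoid is an atomic monoid $M$ such that: (1) left and right cancellation laws hold; (2) any two elements admit a least common multiple and a greatest common divisor on both the left and the right; (3) there is an element $\Delta\in M$ (Garside element) whose set of left divisors equals its set of right divisors, this set $\mathcal{D}$ (the simple divisors) is finite, and it generates $M$. A Garside monoid $G^+$ embeds in its group of fractions $G$, called a Garside group. The Garside element $\Delta$ is tame if there is a constant $c$ such that $\|\Delta^n\|\le cn$ for all $n\ge 1$, where $\|\cdot\|$ is computed in $G^+$. *)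

theory Defs
  imports "HOL-Algebra.Algebra" "HOL-Library.Extended_Real" "HOL-Library.Extended_Nat"
begin

section \<open>Garside monoids\<close>

definition indivisible :: "('a, 'm) monoid_scheme \<Rightarrow> 'a \<Rightarrow> bool" where
  "indivisible M m \<longleftrightarrow> m \<in> carrier M \<and> m \<noteq> \<one>\<^bsub>M\<^esub> \<and>
     (\<forall>a\<in>carrier M. \<forall>b\<in>carrier M. m = a \<otimes>\<^bsub>M\<^esub> b \<longrightarrow> a = \<one>\<^bsub>M\<^esub> \<or> b = \<one>\<^bsub>M\<^esub>)"

text \<open>The identity is the empty product, so the empty list is an expression of it.\<close>

definition mnorm :: "('a, 'm) monoid_scheme \<Rightarrow> 'a \<Rightarrow> enat" where
  "mnorm M m = (SUP xs \<in> {xs. (\<forall>x\<in>set xs. indivisible M x) \<and> foldr (\<otimes>\<^bsub>M\<^esub>) xs \<one>\<^bsub>M\<^esub> = m}.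
     enat (length xs))"

definition generates_monoid :: "('a, 'm) monoid_scheme \<Rightarrow> 'a set \<Rightarrow> bool" where
  "generates_monoid M S \<longleftrightarrow> S \<subseteq> carrier M \<and> (\<lambda>N. submonoid N M) hull S = carrier M"

locale atomic_monoid = monoid M for M (structure) +
  assumes indivisibles_generate: "generates_monoid M {m. indivisible M m}"
    and mnorm_finite: "m \<in> carrier M \<Longrightarrow> mnorm M m < \<infinity>"

text \<open>The library relation \<open>a divides b\<close> means \<open>\<exists>c\<in>carrier M. b = a \<otimes> c\<close>: over a noncommutative
  monoid it is left divisibility, and the gcd and lcm relations built on it are those of left
  divisibility. Their right-hand versions are obtained in the opposite monoid.\<close>

definition opposite :: "('a, 'm) monoid_scheme \<Rightarrow> ('a, 'm) monoid_scheme" where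
  "opposite M = M\<lparr>mult := (\<lambda>x y. y \<otimes>\<^bsub>M\<^esub> x)\<rparr>"

definition left_divisors :: "('a, 'm) monoid_scheme \<Rightarrow> 'a \<Rightarrow> 'a set" where
  "left_divisors M m = {a \<in> carrier M. a divides\<^bsub>M\<^esub> m}"

definition right_divisors :: "('a, 'm) monoid_scheme \<Rightarrow> 'a \<Rightarrow> 'a set" where
  "right_divisors M m = {a \<in> carrier M. a divides\<^bsub>opposite M\<^esub> m}"

lemma right_divisors_iff:
  "a \<in> right_divisors M m \<longleftrightarrow> a \<in> carrier M \<and> (\<exists>c\<in>carrier M. m = c \<otimes>\<^bsub>M\<^esub> a)"
  by (simp add: right_divisors_def opposite_def factor_def)

locale Garside_monoid = atomic_monoid M + monoid_cancel M for M (structure) +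
  fixes \<Delta>
  assumes left_lcm_ex:
      "\<lbrakk>a \<in> carrier M; b \<in> carrier M\<rbrakk> \<Longrightarrow> \<exists>c\<in>carrier M. c lcmof\<^bsub>M\<^esub> a b"
    and left_gcd_ex:
      "\<lbrakk>a \<in> carrier M; b \<in> carrier M\<rbrakk> \<Longrightarrow> \<exists>c\<in>carrier M. c gcdof\<^bsub>M\<^esub> a b"
    and right_lcm_ex:
      "\<lbrakk>a \<in> carrier M; b \<in> carrier M\<rbrakk> \<Longrightarrow> \<exists>c\<in>carrier M. c lcmof\<^bsub>opposite M\<^esub> a b"
    and right_gcd_ex:
      "\<lbrakk>a \<in> carrier M; b \<in> carrier M\<rbrakk> \<Longrightarrow> \<exists>c\<in>carrier M. c gcdof\<^bsub>opposite M\<^esub> a b"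
    and Garside_element_closed: "\<Delta> \<in> carrier M"
    and left_divisors_eq_right_divisors: "left_divisors M \<Delta> = right_divisors M \<Delta>"
    and finite_simple_divisors: "finite (left_divisors M \<Delta>)"
    and simple_divisors_generate: "generates_monoid M (left_divisors M \<Delta>)"

definition tame :: "('a, 'm) monoid_scheme \<Rightarrow> 'a \<Rightarrow> bool" where
  "tame M \<Delta> \<longleftrightarrow> (\<exists>c::real. \<forall>n::nat. n \<ge> 1 \<longrightarrow>
     ereal_of_enat (mnorm M (\<Delta> [^]\<^bsub>M\<^esub> n)) \<le> ereal (c * real n))"


section \<open>Groups\<close>

text \<open>For a cancellative monoid with common multiples (Ore's condition), these conditions determine
  the pair of \<open>G\<close> and \<open>\<iota>\<close> up to unique isomorphism.\<close>

definition group_of_fractions ::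
    "('a, 'm) monoid_scheme \<Rightarrow> ('g, 'n) monoid_scheme \<Rightarrow> ('a \<Rightarrow> 'g) \<Rightarrow> bool" where
  "group_of_fractions M G \<iota> \<longleftrightarrow> group G \<and> \<iota> \<in> mon M G \<and>
     (\<forall>g\<in>carrier G. \<exists>a\<in>carrier M. \<exists>b\<in>carrier M. g = inv\<^bsub>G\<^esub> (\<iota> a) \<otimes>\<^bsub>G\<^esub> \<iota> b)"

definition finitely_generated :: "('g, 'n) monoid_scheme \<Rightarrow> bool" where
  "finitely_generated G \<longleftrightarrow> (\<exists>S\<subseteq>carrier G. finite S \<and> generate G S = carrier G)"

definition virtually ::
    "(('g, 'n) monoid_scheme \<Rightarrow> bool) \<Rightarrow> ('g, 'n) monoid_scheme \<Rightarrow> bool" where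
  "virtually P G \<longleftrightarrow>
     (\<exists>K. subgroup K G \<and> finite (rcosets\<^bsub>G\<^esub> K) \<and> P (G\<lparr>carrier := K\<rparr>))"

end

theory Submission
  imports Defs
begin

text \<open>
  Order the Garside group \<open>G\<close> by left divisibility: \<open>x \<preceq> y\<close> if \<open>x\<^sup>-\<^sup>1 y\<close> lies in the monoid. Left
  translations preserve this order; so does the right multiplication by \<open>\<Delta>\<close>, which is called
  the shift. Intervals are finite, bounded families have joins, and any two elements are comparable up
  to a shift. For a base point \<open>x\<close>, the element \<open>g\<close> is bounded by \<open>s\<close> at \<open>x\<close> if \<open>g x \<preceq> x \<Delta>\<^sup>s\<close>, and
  \<open>conj_sup g\<close> is the least such \<open>s\<close> over all base points. It is a conjugation invariant and a discrete
  form of a translation number.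

  Everything rests on improving base points by joins of orbits. This shows that \<open>conj_sup (g\<^sup>q) \<le> q m\<close>
  implies \<open>conj_sup g \<le> m\<close> (\<open>conj_sup_root\<close>), that \<open>G\<close> is torsion-free, and that commuting elements
  attain their bounds simultaneously (\<open>bounded_at_common_finite\<close>); hence \<open>conj_sup\<close> is subadditive on
  commuting elements, its balls in an abelian subgroup are finite (\<open>conj_ball_finite_card\<close>), and a
  finitely generated abelian subgroup has a base point that is optimal for all of its elements
  (\<open>optimal_base_point_ex\<close>).

  The main point is that abelian subgroups have bounded rank. Geometrically, a flat with an
  optimal base point embeds isometrically into a complex whose local dimension is bounded by the
  number of simple elements. The proof is a count at scale \<open>1/q\<close>: the orbit map of an
  abelian subgroup \<open>A\<close> is extended to formal \<open>q\<close>-th roots of its elements, whose images are chains of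
  length \<open>q\<close> in an interval \<open>[y, y \<Delta>]\<close>. The number of such chains is polynomial in \<open>q\<close>, of a degree that
  depends on \<open>G\<close> only, and the extension is injective up to a bounded error
  (\<open>extension_nearly_injective\<close>). So the number of elements of \<open>A\<close> in a ball of radius \<open>q K\<close> is at most
  polynomial in \<open>q\<close> of that degree (\<open>conj_ball_growth\<close>), which bounds the rank (\<open>rank_bound\<close>).
  Finiteness of balls then upgrades finite rank to finite generation
  (\<open>abelian_subgroup_finitely_generated\<close>).

  Finally, a commutator \<open>z = [x, y]\<close> that commutes with \<open>x\<close> and \<open>y\<close> is trivial, because the bounds of
  its power with exponent \<open>n\<^sup>2\<close> grow only linearly in \<open>n\<close> (\<open>central_commutator_trivial\<close>). A subgroup
  \<open>H\<close> acts by conjugation on a finitely generated abelian normal subgroup through a finite group, since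
  \<open>conj_sup\<close> is invariant. These two facts show that an extension of a virtually abelian subgroup
  by an abelian quotient is virtually abelian (\<open>virtually_abelian_extension\<close>), and the theorem
  follows by induction along the series of a solvable subgroup.
\<close>

section \<open>Groups ordered by a Garside element\<close>

text \<open>
  \<open>P\<close> stands for the image of the monoid in its group of fractions and \<open>D\<close> for that of the Garside
  element; \<open>inv x \<otimes> y \<in> P\<close> is the left divisibility order on the group. The condition \<open>D \<noteq> \<one>\<close>
  excludes the trivial group, where multiplication by \<open>D\<close> would not be strictly increasing.
\<close>

locale garside_order = group G for G (structure) +
  fixes P :: "'a set" and D :: 'a
  assumes pos_subset: "P \<subseteq> carrier G"
    and one_pos: "\<one> \<in> P"
    and pos_mult: "\<lbrakk>p \<in> P; q \<in> P\<rbrakk> \<Longrightarrow> p \<otimes> q \<in> P"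
    and pos_antisym: "\<lbrakk>p \<in> P; inv p \<in> P\<rbrakk> \<Longrightarrow> p = \<one>"
    and D_pos: "D \<in> P"
    and D_neq_one: "D \<noteq> \<one>"
    and conj_pos: "p \<in> P \<Longrightarrow> inv D \<otimes> p \<otimes> D \<in> P"
    and conj_pos': "p \<in> P \<Longrightarrow> D \<otimes> p \<otimes> inv D \<in> P"
    and cofinal: "g \<in> carrier G \<Longrightarrow> \<exists>n::nat. inv g \<otimes> D [^] n \<in> P"
    and join_ex: "\<lbrakk>x \<in> carrier G; y \<in> carrier G\<rbrakk> \<Longrightarrow>
      \<exists>z\<in>carrier G. inv x \<otimes> z \<in> P \<and> inv y \<otimes> z \<in> P \<and>
        (\<forall>w\<in>carrier G. inv x \<otimes> w \<in> P \<longrightarrow> inv y \<otimes> w \<in> P \<longrightarrow> inv z \<otimes> w \<in> P)"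
    and finite_pos_interval: "finite {p \<in> P. inv p \<otimes> D [^] (n::nat) \<in> P}"
begin

definition le :: "'a \<Rightarrow> 'a \<Rightarrow> bool"  (infix \<open>\<preceq>\<close> 50) where
  "x \<preceq> y \<longleftrightarrow> inv x \<otimes> y \<in> P"

definition shift :: "'a \<Rightarrow> int \<Rightarrow> 'a" where
  "shift x n = x \<otimes> D [^] n"

lemma D_closed [simp]: "D \<in> carrier G"
  using D_pos pos_subset by auto

lemma pos_closed: "p \<in> P \<Longrightarrow> p \<in> carrier G"
  using pos_subset by auto

lemma mult_inv_cancel_left:
  assumes "x \<in> carrier G" "y \<in> carrier G"
  shows "x \<otimes> (inv x \<otimes> y) = y" "inv x \<otimes> (x \<otimes> y) = y"
  using assms by (simp_all add: m_assoc [symmetric])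

lemma inv_mult_cancel:
  assumes "x \<in> carrier G" "y \<in> carrier G" "z \<in> carrier G"
  shows "(inv x \<otimes> y) \<otimes> (inv y \<otimes> z) = inv x \<otimes> z"
  using assms by (simp add: m_assoc mult_inv_cancel_left)

lemma le_refl: "x \<in> carrier G \<Longrightarrow> x \<preceq> x"
  by (simp add: le_def one_pos)

lemma le_trans:
  assumes "x \<preceq> y" "y \<preceq> z" "x \<in> carrier G" "y \<in> carrier G" "z \<in> carrier G"
  shows "x \<preceq> z"
  using pos_mult[of "inv x \<otimes> y" "inv y \<otimes> z"] assms by (simp add: le_def inv_mult_cancel)

lemma le_antisym:
  assumes "x \<preceq> y" "y \<preceq> x" "x \<in> carrier G" "y \<in> carrier G"
  shows "x = y"
proof -
  have "inv (inv x \<otimes> y) = inv y \<otimes> x"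
    using assms by (simp add: inv_mult_group)
  then have "inv x \<otimes> y = \<one>"
    using assms pos_antisym[of "inv x \<otimes> y"] by (simp add: le_def)
  then have "x \<otimes> (inv x \<otimes> y) = x" using assms by simp
  then show ?thesis using assms by (simp add: mult_inv_cancel_left)
qed

lemma mult_le_mult_iff:
  assumes "g \<in> carrier G" "x \<in> carrier G" "y \<in> carrier G"
  shows "g \<otimes> x \<preceq> g \<otimes> y \<longleftrightarrow> x \<preceq> y"
proof -
  have "inv (g \<otimes> x) \<otimes> (g \<otimes> y) = inv x \<otimes> y"
    using assms by (simp add: inv_mult_group m_assoc mult_inv_cancel_left)
  then show ?thesis by (simp add: le_def)
qed

lemma le_mult_swap:
  assumes "g \<in> carrier G" "x \<in> carrier G" "y \<in> carrier G"
  shows "g \<otimes> x \<preceq> y \<longleftrightarrow> x \<preceq> inv g \<otimes> y"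
  using mult_le_mult_iff[of "inv g" "g \<otimes> x" y] assms by (simp add: mult_inv_cancel_left)

lemma shift_closed [simp]: "x \<in> carrier G \<Longrightarrow> shift x n \<in> carrier G"
  by (simp add: shift_def)

lemma shift_0 [simp]: "x \<in> carrier G \<Longrightarrow> shift x 0 = x"
  by (simp add: shift_def)

lemma shift_shift [simp]: "x \<in> carrier G \<Longrightarrow> shift (shift x m) n = shift x (m + n)"
  by (simp add: shift_def m_assoc int_pow_mult)

lemma mult_shift: "\<lbrakk>g \<in> carrier G; x \<in> carrier G\<rbrakk> \<Longrightarrow> g \<otimes> shift x n = shift (g \<otimes> x) n"
  by (simp add: shift_def m_assoc)

lemma D_pow_nat_pos: "D [^] (n::nat) \<in> P"
  by (induction n) (auto simp: one_pos D_pos pos_mult)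

lemma conj_pow_nat_pos: "p \<in> P \<Longrightarrow> inv (D [^] (n::nat)) \<otimes> p \<otimes> D [^] n \<in> P"
proof (induction n)
  case 0
  then show ?case by (simp add: pos_closed)
next
  case (Suc n)
  have "inv (D [^] Suc n) \<otimes> p \<otimes> D [^] Suc n = inv D \<otimes> (inv (D [^] n) \<otimes> p \<otimes> D [^] n) \<otimes> D"
    using pos_closed[OF Suc.prems] by (simp add: inv_mult_group m_assoc)
  then show ?case using conj_pos[OF Suc.IH[OF Suc.prems]] by (simp only:)
qed

lemma conj_pow_nat_pos': "p \<in> P \<Longrightarrow> D [^] (n::nat) \<otimes> p \<otimes> inv (D [^] n) \<in> P"
proof (induction n)
  case 0
  then show ?case by (simp add: pos_closed)
next
  case (Suc n)
  have "D [^] Suc n \<otimes> p \<otimes> inv (D [^] Suc n) = D \<otimes> (D [^] n \<otimes> p \<otimes> inv (D [^] n)) \<otimes> inv D"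
    using pos_closed[OF Suc.prems]
    by (simp add: inv_mult_group m_assoc nat_pow_Suc2 del: nat_pow_Suc Group.nat_pow_Suc)
  then show ?case using conj_pos'[OF Suc.IH[OF Suc.prems]] by (simp only:)
qed

lemma conj_pow_pos: "p \<in> P \<Longrightarrow> inv (D [^] (n::int)) \<otimes> p \<otimes> D [^] n \<in> P"
proof (cases n)
  case (nonneg m)
  then show "p \<in> P \<Longrightarrow> ?thesis" using conj_pow_nat_pos[of p m] by (simp add: int_pow_int)
next
  case (neg m)
  then show "p \<in> P \<Longrightarrow> ?thesis"
    using conj_pow_nat_pos'[of p "Suc m"] pos_closed[of p]
    by (simp only: int_pow_neg_int D_closed inv_inv nat_pow_closed)
qed

text \<open>The order is invariant under left translations by definition; it is invariant under right
  multiplication by \<open>D\<close> because conjugation by \<open>D\<close> preserves the positive elements.\<close>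

lemma shift_mono:
  assumes "x \<preceq> y" "x \<in> carrier G" "y \<in> carrier G"
  shows "shift x n \<preceq> shift y n"
proof -
  have "inv (shift x n) \<otimes> shift y n = inv (D [^] n) \<otimes> (inv x \<otimes> y) \<otimes> D [^] n"
    using assms by (simp add: shift_def inv_mult_group m_assoc)
  then show ?thesis using assms conj_pow_pos by (simp add: le_def)
qed

lemma shift_le_iff:
  assumes "x \<in> carrier G" "y \<in> carrier G"
  shows "shift x m \<preceq> y \<longleftrightarrow> x \<preceq> shift y (- m)"
  using shift_mono[of "shift x m" y "-m"] shift_mono[of x "shift y (-m)" m] assms by auto

lemma shift_le_shift:
  assumes "m \<le> n" "x \<in> carrier G"
  shows "shift x m \<preceq> shift x n"
proof -
  have "shift x 0 \<preceq> shift x (int k)" for k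
    using assms D_pow_nat_pos[of k]
    by (simp add: le_def shift_def int_pow_int mult_inv_cancel_left)
  from shift_mono[OF this[of "nat (n - m)"], of m] show ?thesis using assms by simp
qed

lemma le_shift_ex:
  assumes "x \<in> carrier G" "y \<in> carrier G"
  shows "\<exists>n\<ge>0. x \<preceq> shift y n"
proof -
  obtain n :: nat where "inv (inv y \<otimes> x) \<otimes> D [^] n \<in> P"
    using cofinal[of "inv y \<otimes> x"] assms by auto
  then have "x \<preceq> shift y (int n)"
    using assms by (simp add: le_def shift_def inv_mult_group m_assoc int_pow_int)
  then show ?thesis by (metis of_nat_0_le_iff)
qed

lemma finite_interval:
  assumes "x \<in> carrier G" "y \<in> carrier G"
  shows "finite {z \<in> carrier G. x \<preceq> z \<and> z \<preceq> y}"
proof -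
  obtain n where n: "n \<ge> 0" "y \<preceq> shift x n" using le_shift_ex assms by blast
  have "{z \<in> carrier G. x \<preceq> z \<and> z \<preceq> y} \<subseteq> (\<otimes>) x ` {p \<in> P. inv p \<otimes> D [^] (nat n) \<in> P}"
  proof
    fix z assume z: "z \<in> {z \<in> carrier G. x \<preceq> z \<and> z \<preceq> y}"
    then have zz: "z \<preceq> shift x n" using n assms le_trans by auto
    have 1: "inv x \<otimes> z \<in> P" using z by (simp add: le_def)
    have "inv (inv x \<otimes> z) \<otimes> D [^] (nat n) = inv z \<otimes> shift x n"
      using z assms n by (simp add: shift_def inv_mult_group m_assoc pow_nat)
    then have 2: "inv (inv x \<otimes> z) \<otimes> D [^] (nat n) \<in> P"
      using zz by (simp add: le_def)
    have "z = x \<otimes> (inv x \<otimes> z)" using z assms by (simp add: mult_inv_cancel_left)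
    with 1 2 show "z \<in> (\<otimes>) x ` {p \<in> P. inv p \<otimes> D [^] (nat n) \<in> P}" by blast
  qed
  then show ?thesis using finite_pos_interval finite_surj by blast
qed

lemma shift_le_shiftD:
  assumes "x \<in> carrier G" "shift x m \<preceq> shift x n"
  shows "m \<le> n"
proof (rule ccontr)
  assume "\<not> m \<le> n"
  then have "n + 1 \<le> m" by simp
  then have "shift x (n + 1) \<preceq> shift x m" using shift_le_shift assms by blast
  then have "shift x (n + 1) \<preceq> shift x n" using assms le_trans by (meson shift_closed)
  then have "shift x 1 \<preceq> shift x 0"
    using shift_mono[of "shift x (n+1)" "shift x n" "-n"] assms by simp
  moreover have "shift x 0 \<preceq> shift x 1" using shift_le_shift[of 0 1 x] assms by simp
  ultimately have "shift x 1 = shift x 0" using le_antisym assms by simp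
  then show False using assms D_neq_one by (simp add: shift_def)
qed

subsection \<open>Joins of bounded families\<close>

definition is_lub :: "'a set \<Rightarrow> 'a \<Rightarrow> bool" where
  "is_lub Y z \<longleftrightarrow> z \<in> carrier G \<and> (\<forall>y\<in>Y. y \<preceq> z) \<and>
     (\<forall>w\<in>carrier G. (\<forall>y\<in>Y. y \<preceq> w) \<longrightarrow> z \<preceq> w)"

lemma is_lub_closed: "is_lub Y z \<Longrightarrow> z \<in> carrier G"
  by (simp add: is_lub_def)

lemma is_lub_upper: "\<lbrakk>is_lub Y z; y \<in> Y\<rbrakk> \<Longrightarrow> y \<preceq> z"
  by (simp add: is_lub_def)

lemma is_lub_least: "\<lbrakk>is_lub Y z; w \<in> carrier G; \<And>y. y \<in> Y \<Longrightarrow> y \<preceq> w\<rbrakk> \<Longrightarrow> z \<preceq> w"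
  by (simp add: is_lub_def)

lemma is_lubI:
  assumes "z \<in> carrier G" "\<And>y. y \<in> Y \<Longrightarrow> y \<preceq> z"
    and "\<And>w. \<lbrakk>w \<in> carrier G; \<And>y. y \<in> Y \<Longrightarrow> y \<preceq> w\<rbrakk> \<Longrightarrow> z \<preceq> w"
  shows "is_lub Y z"
  using assms by (simp add: is_lub_def)

lemma binary_join_ex:
  assumes "x \<in> carrier G" "y \<in> carrier G"
  shows "\<exists>z. is_lub {x, y} z"
proof -
  obtain z where "z \<in> carrier G" "x \<preceq> z" "y \<preceq> z"
    "\<And>w. \<lbrakk>w \<in> carrier G; x \<preceq> w; y \<preceq> w\<rbrakk> \<Longrightarrow> z \<preceq> w"
    using join_ex[OF assms] by (auto simp: le_def)
  then have "is_lub {x, y} z" by (intro is_lubI) auto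
  then show ?thesis ..
qed

lemma finite_join_ex:
  assumes "finite Y" "Y \<noteq> {}" "Y \<subseteq> carrier G"
  shows "\<exists>z. is_lub Y z"
  using assms
proof (induction Y rule: finite_ne_induct)
  case (singleton x)
  then have "is_lub {x} x" using le_refl by (intro is_lubI) auto
  then show ?case ..
next
  case (insert x Y)
  then obtain z where z: "is_lub Y z" by auto
  then obtain w where w: "is_lub {x, z} w"
    using binary_join_ex[of x z] insert.prems is_lub_closed by auto
  have "is_lub (insert x Y) w"
  proof (rule is_lubI)
    show "w \<in> carrier G" using w is_lub_closed by auto
    show "y \<preceq> w" if "y \<in> insert x Y" for y
      using that insert.prems le_trans[of y z w] is_lub_upper[OF w] is_lub_upper[OF z]
        is_lub_closed[OF w] is_lub_closed[OF z] by auto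
    show "w \<preceq> v" if "v \<in> carrier G" "\<And>y. y \<in> insert x Y \<Longrightarrow> y \<preceq> v" for v
      using that is_lub_least[OF w] is_lub_least[OF z] by auto
  qed
  then show ?case ..
qed

text \<open>An infinite family that is bounded above has a join too: replacing each \<open>y\<close> by its join with
  a fixed member \<open>y\<^sub>0\<close> changes no upper bound and brings the family into a finite interval.\<close>

lemma bounded_join_ex:
  assumes "Y \<noteq> {}" "Y \<subseteq> carrier G" "b \<in> carrier G" "\<And>y. y \<in> Y \<Longrightarrow> y \<preceq> b"
  shows "\<exists>z. is_lub Y z"
proof -
  obtain y0 where y0: "y0 \<in> Y" using assms by auto
  define j where "j y = (SOME z. is_lub {y0, y} z)" for y
  have j: "is_lub {y0, y} (j y)" if "y \<in> Y" for y
    unfolding j_def by (rule someI_ex, rule binary_join_ex) (use y0 that assms(2) in auto)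
  have jint: "j ` Y \<subseteq> {z \<in> carrier G. y0 \<preceq> z \<and> z \<preceq> b}"
  proof (intro subsetI CollectI conjI; elim imageE)
    fix w y assume w: "w = j y" "y \<in> Y"
    show "w \<in> carrier G" using is_lub_closed[OF j] w by auto
    show "y0 \<preceq> w" using is_lub_upper[OF j] w by auto
    show "w \<preceq> b" using is_lub_least[OF j, of y b] w assms y0 by auto
  qed
  then have "finite (j ` Y)" using finite_interval[of y0 b] finite_subset y0 assms by auto
  moreover have "j ` Y \<subseteq> carrier G" using jint by auto
  ultimately obtain z where z: "is_lub (j ` Y) z" using finite_join_ex[of "j ` Y"] assms(1) by auto
  have "is_lub Y z"
  proof (rule is_lubI)
    show "z \<in> carrier G" using is_lub_closed[OF z] .
    show "y \<preceq> z" if "y \<in> Y" for y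
    proof (rule le_trans[of y "j y" z])
      show "y \<preceq> j y" using is_lub_upper[OF j] that by auto
      show "j y \<preceq> z" using is_lub_upper[OF z] that by auto
    qed (use that assms(2) is_lub_closed[OF j] is_lub_closed[OF z] in auto)
    show "z \<preceq> w" if "w \<in> carrier G" "\<And>y. y \<in> Y \<Longrightarrow> y \<preceq> w" for w
    proof (rule is_lub_least[OF z])
      show "v \<preceq> w" if "v \<in> j ` Y" for v
        using that \<open>w \<in> carrier G\<close> \<open>\<And>y. y \<in> Y \<Longrightarrow> y \<preceq> w\<close> y0 is_lub_least[OF j] by auto
    qed (use that in auto)
  qed
  then show ?thesis ..
qed

lemma is_lub_mult:
  assumes Y: "is_lub Y z" "Y \<subseteq> carrier G" and g: "g \<in> carrier G"
  shows "is_lub ((\<otimes>) g ` Y) (g \<otimes> z)"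
proof (rule is_lubI)
  have z: "z \<in> carrier G" using Y is_lub_closed by auto
  then show "g \<otimes> z \<in> carrier G" using g by simp
  show "y \<preceq> g \<otimes> z" if "y \<in> (\<otimes>) g ` Y" for y
    using that Y g z mult_le_mult_iff is_lub_upper[OF Y(1)] by auto
  fix w assume w: "w \<in> carrier G" "\<And>y. y \<in> (\<otimes>) g ` Y \<Longrightarrow> y \<preceq> w"
  have "y \<preceq> inv g \<otimes> w" if "y \<in> Y" for y
    using w(2)[of "g \<otimes> y"] w(1) that Y(2) g le_mult_swap[of g y w] by auto
  then have "z \<preceq> inv g \<otimes> w" using is_lub_least[OF Y(1)] w g by auto
  then show "g \<otimes> z \<preceq> w" using le_mult_swap w g z by auto
qed

lemma is_lub_shift:
  assumes Y: "is_lub Y z" "Y \<subseteq> carrier G"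
  shows "is_lub ((\<lambda>y. shift y n) ` Y) (shift z n)"
proof (rule is_lubI)
  have z: "z \<in> carrier G" using Y is_lub_closed by auto
  then show "shift z n \<in> carrier G" by simp
  show "y \<preceq> shift z n" if "y \<in> (\<lambda>y. shift y n) ` Y" for y
    using that Y z shift_mono is_lub_upper[OF Y(1)] by auto
  fix w assume w: "w \<in> carrier G" "\<And>y. y \<in> (\<lambda>y. shift y n) ` Y \<Longrightarrow> y \<preceq> w"
  have "y \<preceq> shift w (- n)" if "y \<in> Y" for y
    using w(2)[of "shift y n"] w(1) that Y(2) shift_le_iff[of y w n] by auto
  then have "z \<preceq> shift w (- n)" using is_lub_least[OF Y(1)] w by auto
  then show "shift z n \<preceq> w" using shift_le_iff w z by auto
qed

end

section \<open>Optimal base points\<close>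

context garside_order
begin

definition bounded_at :: "'a \<Rightarrow> 'a \<Rightarrow> int \<Rightarrow> bool" where
  "bounded_at x g s \<longleftrightarrow> x \<in> carrier G \<and> g \<in> carrier G \<and> g \<otimes> x \<preceq> shift x s"

lemma bounded_at_closed: "bounded_at x g s \<Longrightarrow> x \<in> carrier G \<and> g \<in> carrier G"
  by (simp add: bounded_at_def)

lemma bounded_at_one: "x \<in> carrier G \<Longrightarrow> bounded_at x \<one> 0"
  by (simp add: bounded_at_def le_refl)

lemma bounded_at_mono:
  assumes "bounded_at x g s" "s \<le> r"
  shows "bounded_at x g r"
  using assms le_trans[of "g \<otimes> x" "shift x s" "shift x r"] shift_le_shift[of s r x]
  unfolding bounded_at_def by simp

lemma bounded_at_mult:
  assumes "bounded_at x g s" "bounded_at x h r"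
  shows "bounded_at x (g \<otimes> h) (s + r)"
proof -
  have c: "x \<in> carrier G" "g \<in> carrier G" "h \<in> carrier G"
    using assms bounded_at_closed by auto
  have "g \<otimes> (h \<otimes> x) \<preceq> g \<otimes> shift x r"
    using assms c mult_le_mult_iff by (simp add: bounded_at_def)
  moreover have "g \<otimes> shift x r \<preceq> shift (shift x s) r"
    using assms c shift_mono[of "g \<otimes> x" "shift x s" r] by (simp add: bounded_at_def mult_shift)
  ultimately show ?thesis
    using c le_trans[of "g \<otimes> (h \<otimes> x)" "g \<otimes> shift x r" "shift x (s + r)"]
    by (simp add: bounded_at_def m_assoc)
qed

lemma bounded_at_pow:
  assumes "bounded_at x g s"
  shows "bounded_at x (g [^] (n::nat)) (int n * s)"
proof (induction n)
  case 0
  then show ?case using assms bounded_at_one bounded_at_closed by simp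
next
  case (Suc n)
  then show ?case using bounded_at_mult[OF Suc assms] by (simp add: algebra_simps)
qed

lemma bounded_at_ex:
  assumes "x \<in> carrier G" "g \<in> carrier G"
  shows "\<exists>s\<ge>0. bounded_at x g s"
  using le_shift_ex[of "g \<otimes> x" x] assms by (auto simp: bounded_at_def)

lemma bounded_at_translate:
  assumes "bounded_at x g s" "h \<in> carrier G"
  shows "bounded_at (h \<otimes> x) (h \<otimes> g \<otimes> inv h) s"
proof -
  have c: "x \<in> carrier G" "g \<in> carrier G" using assms bounded_at_closed by auto
  have "h \<otimes> g \<otimes> inv h \<otimes> (h \<otimes> x) = h \<otimes> (g \<otimes> x)"
    using c assms by (simp add: m_assoc mult_inv_cancel_left)
  then show ?thesis
    using c assms mult_le_mult_iff[of h "g \<otimes> x" "shift x s"]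
    by (simp add: bounded_at_def mult_shift)
qed

text \<open>A bound for \<open>g\<close> at \<open>x\<close> depends only on the conjugate of \<open>g\<close> by \<open>x\<close>: changing the base point amounts
  to changing \<open>g\<close> within its conjugacy class.\<close>

lemma bounded_at_iff_conjugate:
  assumes "x \<in> carrier G" "g \<in> carrier G"
  shows "bounded_at x g s \<longleftrightarrow> inv x \<otimes> g \<otimes> x \<preceq> shift \<one> s"
  using assms mult_le_mult_iff[of "inv x" "g \<otimes> x" "shift x s"]
  by (simp add: bounded_at_def m_assoc mult_shift)

lemma bounded_at_shift:
  assumes "bounded_at x g s"
  shows "bounded_at (shift x n) g s"
  using assms shift_mono[of "g \<otimes> x" "shift x s" n]
  by (simp add: bounded_at_def mult_shift add.commute)

lemma bounded_at_commuting:
  assumes "bounded_at x g s" "h \<in> carrier G" "g \<otimes> h = h \<otimes> g"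
  shows "bounded_at (h \<otimes> x) g s"
proof -
  have "h \<otimes> g \<otimes> inv h = g"
    using assms bounded_at_closed[OF assms(1)] by (metis inv_solve_right m_closed)
  then show ?thesis using bounded_at_translate[OF assms(1,2)] by simp
qed

text \<open>This is why base points can be improved: the points at which \<open>g\<close> is bounded by a given \<open>s\<close> form a
  set closed under joins, as \<open>g\<close> and the shifts commute with joins.\<close>

lemma bounded_at_join:
  assumes Y: "is_lub Y z" "\<And>y. y \<in> Y \<Longrightarrow> bounded_at y g s" and g: "g \<in> carrier G"
  shows "bounded_at z g s"
proof -
  have Yc: "Y \<subseteq> carrier G" using Y bounded_at_closed by blast
  have zc: "z \<in> carrier G" using Y is_lub_closed by blast
  have "g \<otimes> z \<preceq> shift z s"
  proof (rule is_lub_least[OF is_lub_mult[OF Y(1) Yc g]])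
    fix w assume "w \<in> (\<otimes>) g ` Y"
    then obtain y where y: "y \<in> Y" "w = g \<otimes> y" by auto
    have "g \<otimes> y \<preceq> shift y s" using Y y by (simp add: bounded_at_def)
    moreover have "shift y s \<preceq> shift z s"
      using shift_mono is_lub_upper[OF Y(1)] y Yc zc by auto
    ultimately show "w \<preceq> shift z s"
      using le_trans[of w "shift y s" "shift z s"] y Yc zc g by auto
  qed (use zc in simp)
  then show ?thesis using zc g by (simp add: bounded_at_def)
qed

text \<open>Let \<open>z\<close> be the join of the points \<open>g\<^sup>i \<otimes> y\<close> shifted by \<open>- m * i\<close>, for \<open>i < q\<close>. The element \<open>g\<close> carries each
  of these points to the next one shifted by \<open>m\<close>, and by hypothesis the point that follows the last
  one lies below the first one; so \<open>g\<close> carries \<open>z\<close> below its shift by \<open>m\<close>.\<close>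

lemma bounded_at_root:
  assumes "bounded_at y (g [^] q) (int q * m)" "q \<ge> 1" "g \<in> carrier G"
  shows "\<exists>z. bounded_at z g m"
proof -
  define e where "e i = shift (g [^] i \<otimes> y) (- (m * int i))" for i :: nat
  have yc: "y \<in> carrier G" using assms bounded_at_closed by blast
  have ec: "e i \<in> carrier G" for i using yc assms by (simp add: e_def)
  obtain z where z: "is_lub (e ` {..<q}) z"
    using finite_join_ex[of "e ` {..<q}"] ec assms by (auto simp: lessThan_empty_iff)
  have zc: "z \<in> carrier G" using is_lub_closed z by blast
  have e0: "e 0 \<preceq> z" using is_lub_upper[OF z] assms(2) by auto
  have eS: "g \<otimes> e i = shift (e (Suc i)) m" for i
    using yc assms(3) by (simp add: e_def mult_shift nat_pow_Suc2 m_assoc algebra_simps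
        del: nat_pow_Suc Group.nat_pow_Suc)
  have "e q \<preceq> e 0"
    using assms(1) yc shift_mono[of "g [^] q \<otimes> y" "shift y (int q * m)" "- (m * int q)"]
    by (simp add: e_def bounded_at_def mult.commute)
  then have "e i \<preceq> z" if "i \<le> q" for i
    using that e0 le_trans[OF _ e0 ec ec zc] is_lub_upper[OF z] by (cases "i = q") auto
  then have "shift (e (Suc i)) m \<preceq> shift z m" if "i < q" for i
    using that shift_mono[OF _ ec zc] by simp
  then have "g \<otimes> z \<preceq> shift z m"
    using zc ec eS by (intro is_lub_least[OF is_lub_mult[OF z _ assms(3)]]) auto
  then show ?thesis using zc assms by (auto simp: bounded_at_def)
qed

text \<open>For an element of finite order the preceding lemma gives a point with \<open>g \<otimes> z \<preceq> z\<close>; around the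
  cycle of powers of \<open>g\<close> all these inequalities must be equalities.\<close>

lemma torsion_free:
  assumes "g \<in> carrier G" "g [^] (n::nat) = \<one>" "n \<ge> 1"
  shows "g = \<one>"
proof -
  have "bounded_at \<one> (g [^] n) (int n * 0)" using assms bounded_at_one by simp
  then obtain z where z: "bounded_at z g 0" using bounded_at_root assms by blast
  have zc: "z \<in> carrier G" using z bounded_at_closed by blast
  obtain k where k: "n = Suc k" using assms by (cases n) auto
  have "g [^] k \<otimes> z \<preceq> z" using bounded_at_pow[OF z, of k] zc by (simp add: bounded_at_def)
  then have "g \<otimes> (g [^] k \<otimes> z) \<preceq> g \<otimes> z" using mult_le_mult_iff assms zc by simp
  moreover have "g \<otimes> (g [^] k \<otimes> z) = z"
    using assms(1,2) k zc nat_pow_Suc2[of g k] by (simp add: m_assoc [symmetric])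
  moreover have "g \<otimes> z \<preceq> z" using z zc by (simp add: bounded_at_def)
  ultimately have "g \<otimes> z = z" using le_antisym assms zc by simp
  then show ?thesis using assms zc by (metis r_cancel_one')
qed

text \<open>The same join, now over all \<open>i\<close> and starting from \<open>x\<close>, is bounded above because \<open>h\<close> satisfies its
  bound at some point \<open>y\<close> above \<open>x\<close> up to a shift. Its members are translates of \<open>x\<close> by powers of \<open>h\<close>
  and by shifts, so the elements that commute with \<open>h\<close> keep the bounds they have at \<open>x\<close>.\<close>

lemma bounded_at_common:
  assumes h: "bounded_at y h r" and x: "x \<in> carrier G"
  shows "\<exists>z. bounded_at z h r \<and>
    (\<forall>g s. g \<otimes> h = h \<otimes> g \<longrightarrow> bounded_at x g s \<longrightarrow> bounded_at z g s)"
proof -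
  define e where "e i = shift (h [^] i \<otimes> x) (- (r * int i))" for i :: nat
  have c: "y \<in> carrier G" "h \<in> carrier G" using h bounded_at_closed by auto
  have ec: "e i \<in> carrier G" for i using x c by (simp add: e_def)
  obtain n where n: "x \<preceq> shift y n" using le_shift_ex x c by blast
  have "e i \<preceq> shift y n" for i
  proof -
    have "h [^] i \<otimes> x \<preceq> h [^] i \<otimes> shift y n"
      using n c x mult_le_mult_iff by simp
    moreover have "h [^] i \<otimes> shift y n \<preceq> shift (shift y (int i * r)) n"
      using bounded_at_pow[OF h, of i] c
        shift_mono[of "h [^] i \<otimes> y" "shift y (int i * r)" n]
      by (simp add: bounded_at_def mult_shift)
    ultimately have "h [^] i \<otimes> x \<preceq> shift y (int i * r + n)"
      using le_trans[of "h [^] i \<otimes> x" "h [^] i \<otimes> shift y n"] c x by simp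
    then show ?thesis
      using shift_mono[of "h [^] i \<otimes> x" "shift y (int i * r + n)" "- (r * int i)"] c x
      by (simp add: e_def algebra_simps)
  qed
  then obtain z where z: "is_lub (range e) z"
    using bounded_join_ex[of "range e" "shift y n"] ec c by auto
  have zc: "z \<in> carrier G" using is_lub_closed z by blast
  have eS: "h \<otimes> e i = shift (e (Suc i)) r" for i
    using x c by (simp add: e_def mult_shift nat_pow_Suc2 m_assoc algebra_simps
        del: nat_pow_Suc Group.nat_pow_Suc)
  have "shift (e (Suc i)) r \<preceq> shift z r" for i
    using is_lub_upper[OF z] shift_mono[OF _ ec zc] by simp
  then have "h \<otimes> z \<preceq> shift z r"
    using zc ec eS by (intro is_lub_least[OF is_lub_mult[OF z _ c(2)]]) auto
  then have "bounded_at z h r" using zc c by (simp add: bounded_at_def)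
  moreover have "bounded_at z g s" if "g \<otimes> h = h \<otimes> g" "bounded_at x g s" for g s
  proof (rule bounded_at_join[OF z])
    have gc: "g \<in> carrier G" using that bounded_at_closed by auto
    then show "g \<in> carrier G" .
    fix w assume "w \<in> range e"
    then obtain i where w: "w = e i" by auto
    have "g \<otimes> h [^] i = h [^] i \<otimes> g"
    proof (induction i)
      case 0
      then show ?case using gc by simp
    next
      case (Suc i)
      then show ?case using gc c that(1) by (metis m_assoc nat_pow_Suc nat_pow_closed)
    qed
    then show "bounded_at w g s"
      using bounded_at_commuting[OF that(2), of "h [^] i"] c bounded_at_shift
      by (simp add: w e_def)
  qed
  ultimately show ?thesis by blast
qed

lemma bounded_at_common_finite:
  assumes "finite S" "\<And>g. g \<in> S \<Longrightarrow> \<exists>y. bounded_at y g (f g)"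
    and "\<And>g h. \<lbrakk>g \<in> S; h \<in> S\<rbrakk> \<Longrightarrow> g \<otimes> h = h \<otimes> g"
  shows "\<exists>z\<in>carrier G. \<forall>g\<in>S. bounded_at z g (f g)"
  using assms
proof (induction S rule: finite_induct)
  case empty
  then show ?case by auto
next
  case (insert h S)
  then obtain x where x: "x \<in> carrier G" "\<forall>g\<in>S. bounded_at x g (f g)" by auto
  obtain y where y: "bounded_at y h (f h)" using insert by blast
  from bounded_at_common[OF y x(1)] obtain z where z: "bounded_at z h (f h)"
    "\<forall>g s. g \<otimes> h = h \<otimes> g \<longrightarrow> bounded_at x g s \<longrightarrow> bounded_at z g s" by blast
  have "\<forall>g\<in>insert h S. bounded_at z g (f g)" using z x insert.prems(2) by simp
  then show ?case using z bounded_at_closed by blast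
qed

subsection \<open>The minimal bound of a conjugacy class\<close>

text \<open>The least integer exists because the bounds of \<open>g\<close> are bounded below: \<open>g\<close> and \<open>inv g\<close> commute, so
  a bound of \<open>g\<close> and one of \<open>inv g\<close> are attained at one point, where their sum must be nonnegative.\<close>

definition conj_sup :: "'a \<Rightarrow> int" where
  "conj_sup g = (LEAST s. \<exists>y. bounded_at y g s)"

lemma bounded_at_inv_sum_nonneg:
  assumes "bounded_at y g s" "bounded_at z (inv g) r"
  shows "0 \<le> s + r"
proof -
  have g: "g \<in> carrier G" "z \<in> carrier G" using assms bounded_at_closed by auto
  have "g \<otimes> inv g = inv g \<otimes> g" using g by simp
  with bounded_at_common[OF assms(1), of z] assms(2) g
  obtain w where w: "bounded_at w g s" "bounded_at w (inv g) r" by (metis (no_types))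
  have "bounded_at w (g \<otimes> inv g) (s + r)" using bounded_at_mult w by blast
  then have "w \<in> carrier G" "shift w 0 \<preceq> shift w (s + r)"
    using g by (auto simp: bounded_at_def)
  then show ?thesis using shift_le_shiftD by blast
qed

lemma conj_sup_aux:
  assumes "g \<in> carrier G"
  shows "(\<exists>y. bounded_at y g (conj_sup g)) \<and> (\<forall>s. (\<exists>y. bounded_at y g s) \<longrightarrow> conj_sup g \<le> s)"
proof -
  obtain r where r: "bounded_at \<one> (inv g) r" using bounded_at_ex assms by blast
  obtain s0 where s0: "bounded_at \<one> g s0" using bounded_at_ex assms by blast
  \<comment> \<open>All bounds of \<open>g\<close> are at least \<open>- r\<close>, so adding \<open>r\<close> reduces to the least natural number of a set.\<close>
  define N where "N = {n::nat. \<exists>y. bounded_at y g (int n - r)}"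
  have nat_rep: "nat (s + r) \<in> N" "int (nat (s + r)) = s + r" if "bounded_at y g s" for y s
    using that bounded_at_inv_sum_nonneg[OF that r] by (auto simp: N_def)
  define m where "m = int (LEAST n. n \<in> N) - r"
  have "(LEAST n. n \<in> N) \<in> N" using nat_rep(1)[OF s0] by (rule LeastI)
  then have 1: "\<exists>y. bounded_at y g m" by (simp add: N_def m_def)
  have 2: "m \<le> s" if "\<exists>y. bounded_at y g s" for s
  proof -
    from that obtain y where y: "bounded_at y g s" ..
    then have "(LEAST n. n \<in> N) \<le> nat (s + r)" using nat_rep(1) by (intro Least_le)
    then have "int (LEAST n. n \<in> N) \<le> int (nat (s + r))" by (simp only: of_nat_le_iff)
    then show ?thesis using nat_rep(2)[OF y] unfolding m_def by linarith
  qed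
  have "conj_sup g = m" unfolding conj_sup_def using 1 2 by (intro Least_equality) auto
  then show ?thesis using 1 2 by blast
qed

lemma conj_sup_attained: "g \<in> carrier G \<Longrightarrow> \<exists>y. bounded_at y g (conj_sup g)"
  using conj_sup_aux by blast

lemma conj_sup_le: "bounded_at y g s \<Longrightarrow> conj_sup g \<le> s"
  using conj_sup_aux bounded_at_closed by blast

lemma conj_sup_one: "conj_sup \<one> = 0"
proof (rule antisym)
  show "conj_sup \<one> \<le> 0" using conj_sup_le bounded_at_one[of \<one>] by simp
  obtain y where "bounded_at y \<one> (conj_sup \<one>)" using conj_sup_attained by blast
  then show "0 \<le> conj_sup \<one>"
    using bounded_at_inv_sum_nonneg[of y \<one> _ \<one> 0] bounded_at_one[of \<one>] by simp
qed

lemma conj_sup_conjugate_le: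
  assumes "g \<in> carrier G" "h \<in> carrier G"
  shows "conj_sup (h \<otimes> g \<otimes> inv h) \<le> conj_sup g"
  using conj_sup_attained[OF assms(1)] bounded_at_translate assms conj_sup_le by blast

lemma conj_sup_mult:
  assumes "g \<in> carrier G" "h \<in> carrier G" "g \<otimes> h = h \<otimes> g"
  shows "conj_sup (g \<otimes> h) \<le> conj_sup g + conj_sup h"
proof -
  have "\<exists>z\<in>carrier G. \<forall>a\<in>{g, h}. bounded_at z a (conj_sup a)"
    using assms conj_sup_attained by (intro bounded_at_common_finite) auto
  then obtain z where "bounded_at z g (conj_sup g)" "bounded_at z h (conj_sup h)" by auto
  then show ?thesis using bounded_at_mult conj_sup_le by blast
qed

lemma conj_sup_pow:
  assumes "g \<in> carrier G"
  shows "conj_sup (g [^] (n::nat)) \<le> int n * conj_sup g"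
  using conj_sup_attained[OF assms] bounded_at_pow conj_sup_le by blast

lemma conj_sup_root:
  assumes "conj_sup (g [^] (q::nat)) \<le> int q * m" "q \<ge> 1" "g \<in> carrier G"
  shows "conj_sup g \<le> m"
proof -
  obtain y where "bounded_at y (g [^] q) (int q * m)"
    using conj_sup_attained[of "g [^] q"] assms bounded_at_mono by blast
  then show ?thesis using bounded_at_root assms conj_sup_le by blast
qed

text \<open>With \<open>conj_sup_pow\<close> this says \<open>0 \<le> int q * conj_sup g - conj_sup (g [^] q) < int q\<close>: the bounds grow
  linearly along powers, up to a rounding error of less than one per factor.\<close>

lemma conj_sup_pow_lower:
  assumes "q \<ge> 1" "g \<in> carrier G"
  shows "int q * (conj_sup g - 1) + 1 \<le> conj_sup (g [^] (q::nat))"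
  using conj_sup_root[of g q "conj_sup g - 1"] assms by linarith

end

section \<open>Balls in abelian subgroups\<close>

context garside_order
begin

definition ball_at :: "'a \<Rightarrow> int \<Rightarrow> 'a set" where
  "ball_at x r = {g. bounded_at x g r \<and> bounded_at x (inv g) r \<and> g \<in> carrier G}"

lemma ball_at_conjugate:
  assumes "g \<in> ball_at x r"
  shows "inv x \<otimes> g \<otimes> x \<in> ball_at \<one> r"
proof -
  have c: "x \<in> carrier G" "g \<in> carrier G"
    using assms bounded_at_closed by (auto simp: ball_at_def)
  have "inv (inv x \<otimes> g \<otimes> x) = inv x \<otimes> inv g \<otimes> x"
    using c by (simp add: inv_mult_group m_assoc)
  then show ?thesis
    using c assms bounded_at_translate[of x g r "inv x"] bounded_at_translate[of x "inv g" r "inv x"]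
    by (simp add: ball_at_def)
qed

lemma finite_ball_at_one: "finite (ball_at \<one> r)"
proof -
  have "ball_at \<one> r \<subseteq> {z \<in> carrier G. shift \<one> (- r) \<preceq> z \<and> z \<preceq> shift \<one> r}"
  proof
    fix g assume g: "g \<in> ball_at \<one> r"
    then have c: "g \<in> carrier G" by (simp add: ball_at_def)
    have "inv g \<otimes> \<one> \<preceq> shift \<one> r" using g unfolding ball_at_def bounded_at_def by blast
    then have "\<one> \<preceq> shift g r" using c le_mult_swap[of "inv g" \<one> "shift \<one> r"] by (simp add: mult_shift)
    then have "shift \<one> (- r) \<preceq> g" using c shift_le_iff[of \<one> g "- r"] by simp
    then show "g \<in> {z \<in> carrier G. shift \<one> (- r) \<preceq> z \<and> z \<preceq> shift \<one> r}"
      using g c by (simp add: ball_at_def bounded_at_def)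
  qed
  then show ?thesis using finite_interval[of "shift \<one> (- r)" "shift \<one> r"] finite_subset by auto
qed

definition conj_ball :: "'a set \<Rightarrow> int \<Rightarrow> 'a set" where
  "conj_ball A r = {a \<in> A. conj_sup a \<le> r \<and> conj_sup (inv a) \<le> r}"

text \<open>Finitely many elements of an abelian subgroup reach their bounds at a common base point \<open>z\<close>, and
  conjugation by \<open>z\<close> embeds them into a ball at \<open>\<one>\<close>, whose size does not depend on the subgroup.\<close>

lemma conj_ball_finite_card:
  assumes A: "subgroup A G" "\<And>a b. \<lbrakk>a \<in> A; b \<in> A\<rbrakk> \<Longrightarrow> a \<otimes> b = b \<otimes> a"
  shows "finite (conj_ball A r) \<and> card (conj_ball A r) \<le> card (ball_at \<one> r)"
proof (rule finite_if_finite_subsets_card_bdd)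
  interpret A: subgroup A G by fact
  fix Y assume Y: "Y \<subseteq> conj_ball A r" "finite Y"
  define S where "S = Y \<union> m_inv G ` Y"
  have YA: "Y \<subseteq> A" using Y by (auto simp: conj_ball_def)
  then have SA: "S \<subseteq> A" by (auto simp: S_def)
  have "\<exists>z\<in>carrier G. \<forall>g\<in>S. bounded_at z g r"
  proof (rule bounded_at_common_finite)
    show "finite S" using Y by (simp add: S_def)
    show "\<exists>y. bounded_at y g r" if "g \<in> S" for g
    proof -
      have "conj_sup g \<le> r" using that Y unfolding S_def conj_ball_def by auto
      then show ?thesis using that SA A.subset conj_sup_attained[of g] bounded_at_mono by blast
    qed
    show "g \<otimes> h = h \<otimes> g" if "g \<in> S" "h \<in> S" for g h using that SA A(2) by blast
  qed
  then obtain z where z: "z \<in> carrier G" "\<And>g. g \<in> S \<Longrightarrow> bounded_at z g r" by blast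
  have "Y \<subseteq> ball_at z r"
    using z(2) YA by (auto simp: ball_at_def S_def)
  then have "(\<lambda>g. inv z \<otimes> g \<otimes> z) ` Y \<subseteq> ball_at \<one> r"
    using ball_at_conjugate by blast
  moreover have "inj_on (\<lambda>g. inv z \<otimes> g \<otimes> z) Y"
  proof (rule inj_onI)
    fix a b assume "a \<in> Y" "b \<in> Y" "inv z \<otimes> a \<otimes> z = inv z \<otimes> b \<otimes> z"
    moreover have "a \<in> carrier G" "b \<in> carrier G" using calculation YA A.subset by auto
    ultimately show "a = b" using z(1) by simp
  qed
  ultimately show "card Y \<le> card (ball_at \<one> r)"
    using card_inj_on_le finite_ball_at_one by blast
qed

text \<open>The pattern of conjugates of the generators by a base point takes finitely many
  values on the base points that are optimal for the generators, and it decides for which elements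
  of the subgroup a base point is optimal. If each pattern failed for some element, a base
  point optimal for the generators and for one such element per pattern would be a contradiction.\<close>

lemma optimal_base_point_ex:
  assumes S: "finite S" "S \<subseteq> carrier G"
    and comm: "\<And>a b. \<lbrakk>a \<in> generate G S; b \<in> generate G S\<rbrakk> \<Longrightarrow> a \<otimes> b = b \<otimes> a"
  shows "\<exists>x\<in>carrier G. \<forall>a\<in>generate G S. bounded_at x a (conj_sup a)"
proof (rule ccontr)
  assume "\<not> ?thesis"
  then have "\<forall>x\<in>carrier G. \<exists>a\<in>generate G S. \<not> bounded_at x a (conj_sup a)" by blast
  then obtain bad where bad: "\<And>x. x \<in> carrier G \<Longrightarrow> bad x \<in> generate G S"
    "\<And>x. x \<in> carrier G \<Longrightarrow> \<not> bounded_at x (bad x) (conj_sup (bad x))" by metis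
  interpret A: subgroup "generate G S" G using generate_is_subgroup S by blast
  define S' where "S' = S \<union> m_inv G ` S"
  have S'A: "S' \<subseteq> generate G S" by (auto simp: S'_def intro: generate.incl generate.inv)
  define T where "T = {x \<in> carrier G. \<forall>s\<in>S'. bounded_at x s (conj_sup s)}"
  define pattern where "pattern x = restrict (\<lambda>s. inv x \<otimes> s \<otimes> x) S" for x
  have "pattern ` T \<subseteq> PiE S (\<lambda>s. ball_at \<one> (max (conj_sup s) (conj_sup (inv s))))"
  proof (rule image_subsetI, rule PiE_I)
    fix x s assume x: "x \<in> T" and s: "s \<in> S"
    have "bounded_at x s (conj_sup s)" "bounded_at x (inv s) (conj_sup (inv s))"
      using x s by (auto simp: T_def S'_def)
    then have "s \<in> ball_at x (max (conj_sup s) (conj_sup (inv s)))"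
      using s S(2) bounded_at_mono by (auto simp: ball_at_def)
    then show "pattern x s \<in> ball_at \<one> (max (conj_sup s) (conj_sup (inv s)))"
      using ball_at_conjugate s by (simp add: pattern_def)
  qed (simp add: pattern_def)
  then have "finite (pattern ` T)"
    by (rule finite_subset) (intro finite_PiE S(1) finite_ball_at_one)
  then obtain T0 where T0: "T0 \<subseteq> T" "finite T0" "pattern ` T = pattern ` T0"
    using finite_subset_image[of "pattern ` T" pattern T] by blast
  have T0c: "T0 \<subseteq> carrier G" using T0 by (auto simp: T_def)
  define F where "F = S' \<union> bad ` T0"
  have FA: "F \<subseteq> generate G S" using S'A bad(1) T0c by (auto simp: F_def)
  have "\<exists>z\<in>carrier G. \<forall>g\<in>F. bounded_at z g (conj_sup g)"
  proof (rule bounded_at_common_finite)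
    show "finite F" using S T0 by (simp add: F_def S'_def)
    show "\<exists>y. bounded_at y g (conj_sup g)" if "g \<in> F" for g
      using that FA conj_sup_attained by auto
    show "g \<otimes> h = h \<otimes> g" if "g \<in> F" "h \<in> F" for g h using that FA comm by blast
  qed
  then obtain z where z: "z \<in> carrier G" "\<And>g. g \<in> F \<Longrightarrow> bounded_at z g (conj_sup g)" by blast
  have "z \<in> T" using z by (auto simp: T_def F_def)
  then obtain x where x: "x \<in> T0" "pattern z = pattern x" using T0 by auto
  have xc: "x \<in> carrier G" using x T0c by auto
  have conj_eq: "inv z \<otimes> a \<otimes> z = inv x \<otimes> a \<otimes> x" if "a \<in> generate G S" for a
    using that
  proof (induction rule: generate.induct)
    case one
    then show ?case using z xc by simp
  next
    case (incl s)
    then show ?case using fun_cong[OF x(2), of s] by (simp add: pattern_def)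
  next
    case (inv s)
    then have s: "s \<in> carrier G" "inv z \<otimes> s \<otimes> z = inv x \<otimes> s \<otimes> x"
      using S(2) fun_cong[OF x(2), of s] by (auto simp: pattern_def)
    have "inv y \<otimes> inv s \<otimes> y = inv (inv y \<otimes> s \<otimes> y)" if "y \<in> carrier G" for y
      using that s by (simp add: inv_mult_group m_assoc)
    from this[OF z(1)] this[OF xc] show ?case by (simp only: s(2))
  next
    case (eng a b)
    have c: "a \<in> carrier G" "b \<in> carrier G" using eng A.subset by auto
    have "inv y \<otimes> (a \<otimes> b) \<otimes> y = (inv y \<otimes> a \<otimes> y) \<otimes> (inv y \<otimes> b \<otimes> y)" if "y \<in> carrier G" for y
      using c that by (simp add: m_assoc mult_inv_cancel_left)
    then show ?case using eng z xc by simp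
  qed
  have b: "bad x \<in> generate G S" "bad x \<in> carrier G" using bad(1) xc A.subset by auto
  have "bounded_at z (bad x) (conj_sup (bad x))" using z(2) x by (simp add: F_def)
  then have "bounded_at x (bad x) (conj_sup (bad x))"
    using bounded_at_iff_conjugate b conj_eq z xc by simp
  then show False using bad(2) xc by blast
qed

end

section \<open>Polynomial growth of abelian subgroups\<close>

text \<open>For an abelian subgroup \<open>A\<close> with an optimal base point \<open>x\<close>, \<open>conj_sup (inv u \<otimes> a)\<close> is an asymmetric
  distance for which the orbit map \<open>a \<mapsto> a \<otimes> x\<close> is Lipschitz: \<open>a \<otimes> x \<preceq> shift (u \<otimes> x) (conj_sup (inv u \<otimes> a))\<close>.
  The orbit map is extended to the finer lattice of formal \<open>q\<close>-th roots of elements of \<open>A\<close>. The point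
  attached to the root of \<open>u\<close> is the increasing sequence \<open>j \<mapsto> extension j u\<close> in the group, where one
  unit of \<open>j\<close> is the \<open>q\<close>-th part of a shift by one. Dividing elements of the group is impossible
  in general; joins provide the missing points, by the usual formula that extends
  Lipschitz functions from a subset.\<close>

locale optimal_flat = garside_order G P D for G (structure) and P and D +
  fixes A :: "'a set" and x :: 'a and q :: nat
  assumes A_subgroup: "subgroup A G"
    and A_comm: "\<lbrakk>a \<in> A; b \<in> A\<rbrakk> \<Longrightarrow> a \<otimes> b = b \<otimes> a"
    and x_closed: "x \<in> carrier G"
    and x_optimal: "a \<in> A \<Longrightarrow> bounded_at x a (conj_sup a)"
    and q_ge_2: "q \<ge> 2"
begin

interpretation A: subgroup A G by (rule A_subgroup)

lemma pow_in_A: "a \<in> A \<Longrightarrow> a [^] (n::nat) \<in> A"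
  by (induction n) auto

lemma conj_sup_mult_A: "\<lbrakk>a \<in> A; b \<in> A\<rbrakk> \<Longrightarrow> conj_sup (a \<otimes> b) \<le> conj_sup a + conj_sup b"
  using conj_sup_mult[OF _ _ A_comm] by auto

definition extension_term :: "int \<Rightarrow> 'a \<Rightarrow> 'a \<Rightarrow> 'a" where
  "extension_term j u a = shift (a \<otimes> x) ((j - conj_sup (inv u \<otimes> a [^] q)) div int q)"

definition extension :: "int \<Rightarrow> 'a \<Rightarrow> 'a" where
  "extension j u = (SOME z. is_lub (extension_term j u ` A) z)"

lemma extension_term_closed [simp]: "a \<in> A \<Longrightarrow> extension_term j u a \<in> carrier G"
  using x_closed by (simp add: extension_term_def)

lemma extension_terms_subset: "extension_term j u ` A \<subseteq> carrier G"
  by (rule image_subsetI) (rule extension_term_closed)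

text \<open>Here optimality of \<open>x\<close> enters: the distance from \<open>a\<^sup>q\<close> to \<open>u\<close> is at least \<open>q * (conj_sup a - 1) + 1\<close>
  up to a term that depends on \<open>u\<close> only, so the shift in the term of \<open>a\<close> compensates
  the bound \<open>a \<otimes> x \<preceq> shift x (conj_sup a)\<close>.\<close>

lemma extension_term_upper:
  assumes "u \<in> A" "a \<in> A" "conj_sup u \<le> int q * K" "j \<le> int q * J"
  shows "extension_term j u a \<preceq> shift x (J + K)"
proof -
  have ac: "a \<in> carrier G" and uc: "u \<in> carrier G" using assms by auto
  define c where "c = conj_sup (inv u \<otimes> a [^] q)"
  have "u \<otimes> (inv u \<otimes> a [^] q) = a [^] q"
    using ac uc by (simp add: mult_inv_cancel_left)
  then have "conj_sup (a [^] q) \<le> conj_sup u + c"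
    using conj_sup_mult_A[of u "inv u \<otimes> a [^] q"] assms pow_in_A by (simp add: c_def)
  moreover have "int q * (conj_sup a - 1) + 1 \<le> conj_sup (a [^] q)"
    using conj_sup_pow_lower[of q a] q_ge_2 ac by simp
  ultimately have "j - c < int q * (J + K - conj_sup a + 1)"
    using assms(3,4) by (simp add: algebra_simps)
  moreover have "int q * ((j - c) div int q) \<le> j - c"
    using q_ge_2 by (simp add: minus_mod_eq_mult_div [symmetric])
  ultimately have "int q * ((j - c) div int q) < int q * (J + K - conj_sup a + 1)" by linarith
  then have "(j - c) div int q < J + K - conj_sup a + 1"
    using q_ge_2 by (simp only: mult_less_cancel_left_pos of_nat_0_less_iff)
  then have "extension_term j u a \<preceq> shift (a \<otimes> x) (J + K - conj_sup a)"
    unfolding extension_term_def c_def[symmetric] using x_closed ac by (intro shift_le_shift) auto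
  moreover have "shift (a \<otimes> x) (J + K - conj_sup a) \<preceq> shift (shift x (conj_sup a)) (J + K - conj_sup a)"
    using x_optimal[OF assms(2)] x_closed ac by (intro shift_mono) (auto simp: bounded_at_def)
  ultimately show ?thesis
    using le_trans[of "extension_term j u a" "shift (a \<otimes> x) (J + K - conj_sup a)" "shift x (J + K)"]
      x_closed ac assms by simp
qed

lemma extension_is_lub:
  assumes "u \<in> A"
  shows "is_lub (extension_term j u ` A) (extension j u)"
proof -
  have "conj_sup u \<le> int q * \<bar>conj_sup u\<bar>" "j \<le> int q * \<bar>j\<bar>"
    using q_ge_2 mult_right_mono[of 1 "int q" "\<bar>conj_sup u\<bar>"] mult_right_mono[of 1 "int q" "\<bar>j\<bar>"]
    by linarith+
  then have "extension_term j u a \<preceq> shift x (\<bar>j\<bar> + \<bar>conj_sup u\<bar>)" if "a \<in> A" for a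
    using extension_term_upper that assms by blast
  note upper = this
  have ne: "extension_term j u ` A \<noteq> {}" using A.one_closed by blast
  have "\<exists>z. is_lub (extension_term j u ` A) z"
    by (rule bounded_join_ex[OF ne extension_terms_subset
          shift_closed[OF x_closed, of "\<bar>j\<bar> + \<bar>conj_sup u\<bar>"]]) (elim imageE, simp only: upper)
  then show ?thesis unfolding extension_def by (rule someI_ex)
qed

lemma extension_closed [simp]: "u \<in> A \<Longrightarrow> extension j u \<in> carrier G"
  using extension_is_lub is_lub_closed by blast

lemma is_lub_unique: "\<lbrakk>is_lub Y z; is_lub Y w\<rbrakk> \<Longrightarrow> z = w"
  using le_antisym by (simp add: is_lub_def)

lemma extension_lipschitz:
  assumes "u \<in> A" "w \<in> A" "j + conj_sup (inv w \<otimes> u) \<le> k"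
  shows "extension j u \<preceq> extension k w"
proof (rule is_lub_least[OF extension_is_lub[OF assms(1)]])
  show "extension k w \<in> carrier G" using assms by simp
  fix y assume "y \<in> extension_term j u ` A"
  then obtain a where a: "a \<in> A" "y = extension_term j u a" by auto
  have c: "a \<in> carrier G" "u \<in> carrier G" "w \<in> carrier G" using a assms by auto
  have "(inv w \<otimes> u) \<otimes> (inv u \<otimes> a [^] q) = inv w \<otimes> a [^] q"
    using c by (simp add: inv_mult_cancel)
  then have "conj_sup (inv w \<otimes> a [^] q) \<le> conj_sup (inv w \<otimes> u) + conj_sup (inv u \<otimes> a [^] q)"
    using conj_sup_mult_A[of "inv w \<otimes> u" "inv u \<otimes> a [^] q"] a assms pow_in_A by simp
  then have "(j - conj_sup (inv u \<otimes> a [^] q)) div int q \<le> (k - conj_sup (inv w \<otimes> a [^] q)) div int q"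
    using assms(3) q_ge_2 by (intro zdiv_mono1) auto
  then have "y \<preceq> extension_term k w a"
    unfolding a(2) extension_term_def using c x_closed by (intro shift_le_shift) auto
  moreover have "extension_term k w a \<preceq> extension k w"
    using is_lub_upper[OF extension_is_lub[OF assms(2)]] a by blast
  ultimately show "y \<preceq> extension k w"
    using le_trans[of y "extension_term k w a" "extension k w"] a assms by simp
qed

lemma extension_mono: "\<lbrakk>u \<in> A; j \<le> k\<rbrakk> \<Longrightarrow> extension j u \<preceq> extension k u"
  using extension_lipschitz[of u u j k] conj_sup_one by simp

lemma extension_period:
  assumes "u \<in> A"
  shows "extension (j + int q * n) u = shift (extension j u) n"
proof -
  have "extension_term (j + int q * n) u a = shift (extension_term j u a) n" if "a \<in> A" for a
  proof -
    have "(j + int q * n - c) div int q = (j - c) div int q + n" for c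
      using q_ge_2 div_mult_self2[of "int q" "j - c" n] by (simp add: algebra_simps)
    then show ?thesis using that x_closed by (simp add: extension_term_def)
  qed
  then have "extension_term (j + int q * n) u ` A = (\<lambda>y. shift y n) ` (extension_term j u ` A)"
    by (simp add: image_image)
  moreover have "is_lub ((\<lambda>y. shift y n) ` (extension_term j u ` A)) (shift (extension j u) n)"
    by (rule is_lub_shift[OF extension_is_lub[OF assms]]) auto
  ultimately show ?thesis using is_lub_unique extension_is_lub[OF assms] by metis
qed

lemma extension_equivariant:
  assumes "u \<in> A" "b \<in> A"
  shows "extension j (b [^] q \<otimes> u) = b \<otimes> extension j u"
proof -
  have c: "b \<in> carrier G" "u \<in> carrier G" using assms by auto
  have eq: "b \<otimes> extension_term j u a = extension_term j (b [^] q \<otimes> u) (b \<otimes> a)" if a: "a \<in> A" for a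
  proof -
    have ac: "a \<in> carrier G" using a by auto
    have "(b \<otimes> a) [^] q = b [^] q \<otimes> a [^] q"
      using pow_mult_distrib[OF A_comm[OF assms(2) a] c(1) ac] .
    then have "inv (b [^] q \<otimes> u) \<otimes> (b \<otimes> a) [^] q = inv u \<otimes> a [^] q"
      using c ac by (simp add: inv_mult_group m_assoc mult_inv_cancel_left)
    then show ?thesis using c ac x_closed by (simp add: extension_term_def mult_shift m_assoc)
  qed
  have "(\<otimes>) b ` A = A"
  proof (intro equalityI subsetI)
    fix a assume "a \<in> A"
    then have "a = b \<otimes> (inv b \<otimes> a)" "inv b \<otimes> a \<in> A"
      using assms c by (auto simp: mult_inv_cancel_left)
    then show "a \<in> (\<otimes>) b ` A" by blast
  qed (use assms in auto)
  then have "extension_term j (b [^] q \<otimes> u) ` A = extension_term j (b [^] q \<otimes> u) ` ((\<otimes>) b ` A)"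
    by simp
  also have "\<dots> = (\<otimes>) b ` (extension_term j u ` A)"
    using eq by (auto simp: image_image)
  finally have "extension_term j (b [^] q \<otimes> u) ` A = (\<otimes>) b ` (extension_term j u ` A)" .
  moreover have "is_lub ((\<otimes>) b ` (extension_term j u ` A)) (b \<otimes> extension j u)"
    by (rule is_lub_mult[OF extension_is_lub[OF assms(1)] extension_terms_subset c(1)])
  ultimately have "is_lub (extension_term j (b [^] q \<otimes> u) ` A) (b \<otimes> extension j u)" by simp
  moreover have "b [^] q \<otimes> u \<in> A" using assms pow_in_A by simp
  ultimately show ?thesis using is_lub_unique extension_is_lub by blast
qed

text \<open>If \<open>u\<close> and \<open>v \<otimes> u\<close> have the same image, then moving the image by \<open>v\<close>, which is what \<open>v\<^sup>q\<close> does to \<open>u\<close>,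
  costs only as much as moving it by \<open>v\<^sup>q\<^sup>-\<^sup>1\<close>. Iterating \<open>q\<close> times gives
  \<open>conj_sup (v\<^sup>q) \<le> conj_sup (v\<^sup>q\<^sup>-\<^sup>1)\<close>; since \<open>conj_sup\<close> grows linearly along the powers of \<open>v\<close> up to
  the rounding error in \<open>conj_sup_pow_lower\<close>, this leaves only values at most one.\<close>

lemma extension_nearly_injective:
  assumes "u \<in> A" "v \<in> A" and eq: "\<And>j. extension j (v \<otimes> u) = extension j u"
  shows "conj_sup v \<le> 1"
proof -
  have c: "v \<in> carrier G" "u \<in> carrier G" using assms by auto
  define s where "s = conj_sup (v [^] (q - 1))"
  have step: "v \<otimes> extension j u \<preceq> extension (j + s) u" for j
  proof -
    have "v [^] q = v \<otimes> v [^] (q - 1)"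
      using nat_pow_Suc2[OF c(1), of "q - 1"] q_ge_2 by (simp del: nat_pow_Suc Group.nat_pow_Suc)
    then have "v [^] q \<otimes> u = v \<otimes> u \<otimes> v [^] (q - 1)"
      using c A_comm[OF assms(1) pow_in_A[OF assms(2)], of "q - 1"] by (simp add: m_assoc)
    then have "inv (v \<otimes> u) \<otimes> (v [^] q \<otimes> u) = v [^] (q - 1)"
      using c by (simp add: mult_inv_cancel_left)
    then have "extension j (v [^] q \<otimes> u) \<preceq> extension (j + s) (v \<otimes> u)"
      using assms pow_in_A by (intro extension_lipschitz) (simp_all add: s_def)
    then show ?thesis using extension_equivariant assms by simp
  qed
  have iter: "v [^] p \<otimes> extension j u \<preceq> extension (j + int p * s) u" for p j
  proof (induction p arbitrary: j)
    case 0
    then show ?case using assms le_refl by simp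
  next
    case (Suc p)
    have "v [^] p \<otimes> (v \<otimes> extension j u) \<preceq> v [^] p \<otimes> extension (j + s) u"
      using step c assms mult_le_mult_iff by simp
    moreover have "v [^] p \<otimes> extension (j + s) u \<preceq> extension (j + s + int p * s) u"
      by (rule Suc.IH)
    ultimately show ?case
      using le_trans[of "v [^] p \<otimes> (v \<otimes> extension j u)" "v [^] p \<otimes> extension (j + s) u"] c assms
      by (simp add: m_assoc algebra_simps)
  qed
  have "bounded_at (extension 0 u) (v [^] q) s"
    using iter[of q 0] extension_period[OF assms(1), of 0 s] c assms by (simp add: bounded_at_def)
  then have vq: "conj_sup (v [^] q) \<le> s" by (rule conj_sup_le)
  \<comment> \<open>The exponent \<open>q * (q - 1)\<close> is estimated from below by the power \<open>q\<close> of \<open>v [^] (q - 1)\<close> and from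
    above by the power \<open>q - 1\<close> of \<open>v [^] q\<close>.\<close>
  have "int q * (s - 1) + 1 \<le> conj_sup ((v [^] (q - 1)) [^] q)"
    using conj_sup_pow_lower[of q "v [^] (q - 1)"] q_ge_2 c by (simp add: s_def)
  also have "(v [^] (q - 1)) [^] q = (v [^] q) [^] (q - 1)"
    using c by (simp add: nat_pow_pow mult.commute)
  also have "conj_sup \<dots> \<le> int (q - 1) * conj_sup (v [^] q)" using conj_sup_pow c by simp
  also have "\<dots> \<le> int (q - 1) * s" using vq by (intro mult_left_mono) auto
  also have "\<dots> = int q * s - s" using q_ge_2 by (simp add: algebra_simps of_nat_diff)
  finally have "s \<le> int (q - 1) * 1" using q_ge_2 by (simp add: algebra_simps of_nat_diff)
  then show ?thesis using conj_sup_root[of v "q - 1" 1] q_ge_2 c by (simp add: s_def)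
qed

end

subsection \<open>Counting extended points\<close>

lemma downward_closed_eq_lessThan:
  fixes S :: "nat set"
  assumes "S \<subseteq> {..<q}" "\<And>i j. \<lbrakk>j \<in> S; i \<le> j\<rbrakk> \<Longrightarrow> i \<in> S"
  shows "S = {..<card S}"
proof -
  define m where "m = (LEAST n. n \<notin> S)"
  have "q \<notin> S" using assms(1) by auto
  then have "m \<notin> S" unfolding m_def by (rule LeastI)
  moreover have "i \<in> S" if "i < m" for i
    using not_less_Least[of i "\<lambda>n. n \<notin> S"] that by (auto simp: m_def)
  ultimately have "S = {..<m}" using assms(2) by (metis lessThan_iff linorder_not_less subsetI subset_antisym)
  then show ?thesis by simp
qed

lemma card_le_fibre_bound:
  assumes "finite U" "\<Phi> ` U \<subseteq> V" "finite V"
    and "\<And>u. u \<in> U \<Longrightarrow> card {w \<in> U. \<Phi> w = \<Phi> u} \<le> N"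
  shows "card U \<le> N * card V"
proof -
  have "card U = (\<Sum>u\<in>U. 1)" by simp
  also have "\<dots> = (\<Sum>y\<in>\<Phi> ` U. card {u \<in> U. \<Phi> u = y})"
    using sum.image_gen[OF assms(1), of "\<lambda>_. 1::nat" \<Phi>] by simp
  also have "\<dots> \<le> (\<Sum>y\<in>\<Phi> ` U. N)" using assms(4) by (intro sum_mono) auto
  also have "\<dots> \<le> N * card V" using card_mono[OF assms(3,2)] by simp
  finally show ?thesis .
qed

context garside_order
begin

definition simples :: "'a set" where
  "simples = {d \<in> carrier G. \<one> \<preceq> d \<and> d \<preceq> shift \<one> 1}"

lemma finite_simples: "finite simples"
  unfolding simples_def by (intro finite_interval) auto

end

context optimal_flat
begin

interpretation A: subgroup A G by (rule A_subgroup)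

text \<open>Between \<open>0\<close> and \<open>q\<close> the sequence \<open>j \<mapsto> extension j u\<close> climbs from its initial point to the shift of
  that point by one, so it visits only products of the initial point with simple elements. Being
  increasing, it is determined by the number of indices it spends below each of these products.\<close>

definition codes :: "'a \<Rightarrow> 'a \<times> ('a \<Rightarrow> nat)" where
  "codes u = (extension 0 u, restrict (\<lambda>d. card {j \<in> {..<q}. extension (int j) u \<preceq> extension 0 u \<otimes> d}) simples)"

lemma extension_eq_of_codes_eq:
  assumes u: "u \<in> A" and w: "w \<in> A" and eq: "codes u = codes w"
  shows "extension j u = extension j w"
proof -
  have eq0: "extension 0 u = extension 0 w" using eq by (simp add: codes_def)
  have cards: "card {j \<in> {..<q}. extension (int j) u \<preceq> extension 0 u \<otimes> d}
      = card {j \<in> {..<q}. extension (int j) w \<preceq> extension 0 w \<otimes> d}" if "d \<in> simples" for d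
  proof -
    have "snd (codes u) d = snd (codes w) d" using eq by simp
    then show ?thesis using that unfolding codes_def by simp
  qed
  have down: "{j \<in> {..<q}. extension (int j) v \<preceq> y} = {..<card {j \<in> {..<q}. extension (int j) v \<preceq> y}}"
    if "v \<in> A" "y \<in> carrier G" for v y
  proof (rule downward_closed_eq_lessThan)
    fix i j assume ij: "j \<in> {j \<in> {..<q}. extension (int j) v \<preceq> y}" "i \<le> j"
    have "extension (int i) v \<preceq> extension (int j) v" using that ij by (intro extension_mono) auto
    then show "i \<in> {j \<in> {..<q}. extension (int j) v \<preceq> y}"
      using ij that le_trans[of "extension (int i) v" "extension (int j) v" y] by simp
  qed auto
  have half: "extension (int i) w' \<preceq> extension (int i) u'"
    if i: "i < q" and uw: "u' \<in> A" "w' \<in> A" "extension 0 u' = extension 0 w'"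
      and cs: "\<And>d. d \<in> simples \<Longrightarrow> card {j \<in> {..<q}. extension (int j) u' \<preceq> extension 0 u' \<otimes> d}
      = card {j \<in> {..<q}. extension (int j) w' \<preceq> extension 0 w' \<otimes> d}" for i u' w'
  proof -
    define d where "d = inv (extension 0 u') \<otimes> extension (int i) u'"
    have ext: "extension 0 u' \<otimes> d = extension (int i) u'"
      using uw by (simp add: d_def mult_inv_cancel_left)
    have dc: "d \<in> carrier G" using uw by (simp add: d_def)
    have "extension 0 u' \<otimes> \<one> \<preceq> extension 0 u' \<otimes> d"
      using ext extension_mono[OF uw(1), of 0 "int i"] uw by simp
    moreover have "extension 0 u' \<otimes> d \<preceq> extension 0 u' \<otimes> shift \<one> 1"
      using ext extension_mono[OF uw(1), of "int i" "int q"] extension_period[OF uw(1), of 0 1] uw i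
      by (simp add: mult_shift)
    ultimately have "d \<in> simples"
      using uw dc mult_le_mult_iff[of "extension 0 u'" \<one> d]
        mult_le_mult_iff[of "extension 0 u'" d "shift \<one> 1"]
      by (simp add: simples_def)
    from cs[OF this] have "{j \<in> {..<q}. extension (int j) u' \<preceq> extension 0 u' \<otimes> d}
        = {j \<in> {..<q}. extension (int j) w' \<preceq> extension 0 w' \<otimes> d}"
      using down[OF uw(1), of "extension 0 u' \<otimes> d"] down[OF uw(2), of "extension 0 w' \<otimes> d"] uw dc
      by simp
    moreover have "i \<in> {j \<in> {..<q}. extension (int j) u' \<preceq> extension 0 u' \<otimes> d}"
      using i ext uw le_refl by simp
    ultimately show ?thesis using ext uw(3) by simp
  qed
  have fundamental: "extension (int i) u = extension (int i) w" if "i < q" for i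
    using half[OF that u w eq0 cards] half[OF that w u eq0[symmetric] cards[symmetric]] u w
    by (intro le_antisym) auto
  have "j = int (nat (j mod int q)) + int q * (j div int q)" "nat (j mod int q) < q"
    using q_ge_2 by (auto simp: nat_less_iff)
  then show ?thesis using fundamental extension_period u w by metis
qed

text \<open>The initial point of an extension has finitely many possible values, independently of \<open>q\<close>; each of
  the counts in \<open>codes\<close> takes at most \<open>q + 1\<close> values; and elements with the same code differ by a
  member of a fixed ball, by \<open>extension_nearly_injective\<close>. What matters later is that the degree of this
  polynomial bound in \<open>q\<close> is the same for all abelian subgroups.\<close>

theorem conj_ball_growth:
  assumes "K \<ge> 0"
  shows "card (conj_ball A (int q * K)) \<le> card (ball_at \<one> 1) *
    (card {z \<in> carrier G. shift x (- K) \<preceq> z \<and> z \<preceq> shift x K} * (q + 1) ^ card simples)"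
proof -
  define U where "U = conj_ball A (int q * K)"
  define I where "I = {z \<in> carrier G. shift x (- K) \<preceq> z \<and> z \<preceq> shift x K}"
  define V where "V = I \<times> PiE simples (\<lambda>_. {..q})"
  have finU: "finite (conj_ball A r) \<and> card (conj_ball A r) \<le> card (ball_at \<one> r)" for r
    by (rule conj_ball_finite_card[OF A_subgroup A_comm])
  have UA: "U \<subseteq> A" by (auto simp: U_def conj_ball_def)
  have "finite I" using finite_interval x_closed by (simp add: I_def)
  then have "finite V" using finite_simples by (simp add: V_def finite_PiE)
  moreover have "codes ` U \<subseteq> V"
  proof (rule image_subsetI)
    fix u assume u: "u \<in> U"
    then have uA: "u \<in> A" and su: "conj_sup u \<le> int q * K" "conj_sup (inv u) \<le> int q * K"
      by (auto simp: U_def conj_ball_def)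
    have uc: "u \<in> carrier G" using uA by simp
    have "extension 0 u \<preceq> shift x K"
    proof (rule is_lub_least[OF extension_is_lub[OF uA]])
      fix y assume "y \<in> extension_term 0 u ` A"
      then show "y \<preceq> shift x K" using extension_term_upper[OF uA _ su(1), of _ 0 0] by auto
    qed (use x_closed in simp)
    moreover have "shift x (- K) \<preceq> extension 0 u"
    proof -
      have "(- K) * int q div int q \<le> (0 - conj_sup (inv u)) div int q"
        using su(2) q_ge_2 by (intro zdiv_mono1) (auto simp: mult.commute)
      moreover have "(- K) * int q div int q = - K"
        using q_ge_2 by (intro nonzero_mult_div_cancel_right) simp
      ultimately have "- K \<le> (0 - conj_sup (inv u)) div int q" by simp
      then have "shift x (- K) \<preceq> extension_term 0 u \<one>"
        unfolding extension_term_def using x_closed uc shift_le_shift by simp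
      moreover have "extension_term 0 u \<one> \<preceq> extension 0 u"
        using is_lub_upper[OF extension_is_lub[OF uA]] A.one_closed by blast
      ultimately show ?thesis
        using le_trans[of "shift x (- K)" "extension_term 0 u \<one>" "extension 0 u"] x_closed uA by simp
    qed
    ultimately have "extension 0 u \<in> I" using uA by (simp add: I_def)
    moreover have "restrict (\<lambda>d. card {j \<in> {..<q}. extension (int j) u \<preceq> extension 0 u \<otimes> d}) simples
        \<in> PiE simples (\<lambda>_. {..q})"
    proof (rule restrict_PiE_iff[THEN iffD2], rule ballI)
      fix d
      have "card {j \<in> {..<q}. extension (int j) u \<preceq> extension 0 u \<otimes> d} \<le> card {..<q}"
        by (intro card_mono) auto
      then show "card {j \<in> {..<q}. extension (int j) u \<preceq> extension 0 u \<otimes> d} \<in> {..q}" by simp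
    qed
    ultimately show "codes u \<in> V" by (simp add: codes_def V_def)
  qed
  moreover have "card {w \<in> U. codes w = codes u} \<le> card (ball_at \<one> 1)" if u: "u \<in> U" for u
  proof -
    have uA: "u \<in> A" and uc: "u \<in> carrier G" using u UA by auto
    have near: "conj_sup (w \<otimes> inv v) \<le> 1" if "w \<in> A" "v \<in> A" "codes w = codes v" for w v
    proof (rule extension_nearly_injective[OF that(2)])
      have "w \<otimes> inv v \<otimes> v = w" using that by (simp add: m_assoc)
      then show "extension j (w \<otimes> inv v \<otimes> v) = extension j v" for j
        using extension_eq_of_codes_eq[OF that, of j] by (simp only:)
    qed (use that in simp)
    have "(\<lambda>w. w \<otimes> inv u) ` {w \<in> U. codes w = codes u} \<subseteq> conj_ball A 1"
    proof (rule image_subsetI)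
      fix w assume "w \<in> {w \<in> U. codes w = codes u}"
      then have w: "w \<in> A" "w \<in> carrier G" "codes w = codes u" using UA by auto
      then have "inv (w \<otimes> inv u) = u \<otimes> inv w" using uc by (simp add: inv_mult_group)
      then show "w \<otimes> inv u \<in> conj_ball A 1"
        using near[of w u] near[of u w] w uA by (simp add: conj_ball_def)
    qed
    moreover have "inj_on (\<lambda>w. w \<otimes> inv u) {w \<in> U. codes w = codes u}"
    proof (rule inj_onI)
      fix w w' assume "w \<in> {w \<in> U. codes w = codes u}" "w' \<in> {w \<in> U. codes w = codes u}"
        and eq: "w \<otimes> inv u = w' \<otimes> inv u"
      then have "w \<in> carrier G" "w' \<in> carrier G" using UA by auto
      then show "w = w'" using eq uc by simp
    qed
    ultimately have "card {w \<in> U. codes w = codes u} \<le> card (conj_ball A 1)"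
      using finU[of 1] by (intro card_inj_on_le[where f = "\<lambda>w. w \<otimes> inv u"]) auto
    then show ?thesis using finU[of 1] by simp
  qed
  ultimately have "card U \<le> card (ball_at \<one> 1) * card V"
    using finU by (intro card_le_fibre_bound[where \<Phi> = codes]) (auto simp: U_def)
  moreover have "card V = card I * (q + 1) ^ card simples"
    using finite_simples by (simp add: V_def card_PiE card_cartesian_product)
  ultimately show ?thesis by (simp add: U_def I_def)
qed

end

section \<open>Abelian subgroups are finitely generated\<close>

context group
begin

primrec box :: "'a list \<Rightarrow> nat \<Rightarrow> 'a set" where
  "box [] q = {\<one>}"
| "box (a # as) q = {a [^] n \<otimes> b | n b. n < q \<and> b \<in> box as q}"

text \<open>In an abelian group these are the lists that freely generate a free abelian subgroup. The recursive
  form avoids exponent vectors.\<close>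

primrec indep :: "'a list \<Rightarrow> bool" where
  "indep [] \<longleftrightarrow> True"
| "indep (a # as) \<longleftrightarrow> indep as \<and> (\<forall>n::nat. n \<ge> 1 \<longrightarrow> a [^] n \<notin> generate G (set as))"

lemma nat_pow_in_subgroup: "\<lbrakk>subgroup H G; a \<in> H\<rbrakk> \<Longrightarrow> a [^] (n::nat) \<in> H"
  by (induction n) (auto simp: subgroup.one_closed subgroup.m_closed)

lemma box_subset_generate:
  assumes "set as \<subseteq> carrier G"
  shows "box as q \<subseteq> generate G (set as)"
  using assms
proof (induction as)
  case Nil
  then show ?case by (simp add: generate.one)
next
  case (Cons a as)
  have sub: "subgroup (generate G (set (a # as))) G"
    using Cons.prems generate_is_subgroup by blast
  have "a \<in> generate G (set (a # as))" by (simp add: generate.incl)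
  moreover have "generate G (set as) \<subseteq> generate G (set (a # as))"
    by (rule mono_generate) auto
  ultimately show ?case
    using Cons nat_pow_in_subgroup[OF sub] subgroup.m_closed[OF sub] by auto
qed

lemma card_box:
  assumes "set as \<subseteq> carrier G" "indep as"
  shows "finite (box as q) \<and> card (box as q) = q ^ length as"
  using assms
proof (induction as)
  case Nil
  then show ?case by simp
next
  case (Cons a as)
  have a: "a \<in> carrier G" and as: "set as \<subseteq> carrier G" using Cons.prems by auto
  have sub: "subgroup (generate G (set as)) G" using as generate_is_subgroup by blast
  have bc: "b \<in> generate G (set as) \<and> b \<in> carrier G" if "b \<in> box as q" for b
    using that box_subset_generate[OF as] subgroup.subset[OF sub] by blast
  have img: "box (a # as) q = (\<lambda>(n, b). a [^] n \<otimes> b) ` ({..<q} \<times> box as q)" by auto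
  have aux: "n = n' \<and> b = b'"
    if nn: "n \<le> n'" and b: "b \<in> box as q" "b' \<in> box as q" and eq: "a [^] n \<otimes> b = a [^] n' \<otimes> b'"
    for n n' :: nat and b b'
  proof -
    have "a [^] n' = a [^] n \<otimes> a [^] (n' - n)" using nn a by (simp add: nat_pow_mult)
    then have "a [^] n \<otimes> b = a [^] n \<otimes> (a [^] (n' - n) \<otimes> b')"
      using eq a bc[OF b(2)] by (simp add: m_assoc)
    then have e: "b = a [^] (n' - n) \<otimes> b'" using a bc b by simp
    then have "a [^] (n' - n) = b \<otimes> inv b'" using a bc b by (simp add: m_assoc)
    also have "\<dots> \<in> generate G (set as)"
      using bc b sub by (simp add: subgroup.m_closed subgroup.m_inv_closed)
    finally have "\<not> n' - n \<ge> 1" using Cons.prems(2) unfolding indep.simps by blast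
    then show ?thesis using nn e bc b by simp
  qed
  have "inj_on (\<lambda>(n, b). a [^] n \<otimes> b) ({..<q} \<times> box as q)"
  proof (rule inj_onI, clarify)
    fix n n' :: nat and b b' assume h: "b \<in> box as q" "b' \<in> box as q" "a [^] n \<otimes> b = a [^] n' \<otimes> b'"
    show "n = n' \<and> b = b'"
      using aux[of n n' b b'] aux[of n' n b' b] h by (cases "n \<le> n'") auto
  qed
  moreover have "finite (box as q)" "card (box as q) = q ^ length as"
    using Cons as by auto
  ultimately show ?case unfolding img by (simp add: card_image card_cartesian_product)
qed

lemma generate_insert_commuting:
  assumes "insert a S \<subseteq> carrier G" "b \<in> generate G (insert a S)"
    and comm: "\<And>b c. \<lbrakk>b \<in> generate G (insert a S); c \<in> generate G (insert a S)\<rbrakk> \<Longrightarrow> b \<otimes> c = c \<otimes> b"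
  shows "\<exists>z::int. \<exists>c\<in>generate G S. b = a [^] z \<otimes> c"
  using assms(2)
proof (induction rule: generate.induct)
  case one
  have "\<one> = a [^] (0::int) \<otimes> \<one>" by simp
  then show ?case using generate.one by blast
next
  case (incl h)
  show ?case
  proof (cases "h = a")
    case True
    then have "h = a [^] (1::int) \<otimes> \<one>" using assms(1) by simp
    then show ?thesis using generate.one by blast
  next
    case False
    then have "h = a [^] (0::int) \<otimes> h" "h \<in> generate G S"
      using incl assms(1) by (auto intro: generate.incl)
    then show ?thesis by blast
  qed
next
  case (inv h)
  show ?case
  proof (cases "h = a")
    case True
    then have "inv h = a [^] (-1::int) \<otimes> \<one>" using assms(1) by (simp add: int_pow_neg)
    then show ?thesis using generate.one by blast
  next
    case False
    then have "inv h = a [^] (0::int) \<otimes> inv h" "inv h \<in> generate G S"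
      using inv assms(1) by (auto intro: generate.inv)
    then show ?thesis by blast
  qed
next
  case (eng h k)
  then obtain z c w d where h: "c \<in> generate G S" "h = a [^] (z::int) \<otimes> c"
    and k: "d \<in> generate G S" "k = a [^] (w::int) \<otimes> d" by blast
  have sub: "subgroup (generate G (insert a S)) G" using assms(1) generate_is_subgroup by blast
  have mono: "generate G S \<subseteq> generate G (insert a S)" by (rule mono_generate) auto
  have ca: "a \<in> carrier G" using assms(1) by auto
  have cc: "c \<in> carrier G" "d \<in> carrier G" using h(1) k(1) mono subgroup.subset[OF sub] by blast+
  have "a [^] w \<in> generate G (insert a S)"
    using subgroup_int_pow_closed[OF sub] by (simp add: generate.incl)
  then have sw: "c \<otimes> a [^] w = a [^] w \<otimes> c" using comm h(1) mono by blast
  have "h \<otimes> k = a [^] z \<otimes> (c \<otimes> a [^] w) \<otimes> d" using h k ca cc by (simp add: m_assoc)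
  also have "\<dots> = (a [^] z \<otimes> a [^] w) \<otimes> (c \<otimes> d)" unfolding sw using ca cc by (simp add: m_assoc)
  also have "\<dots> = a [^] (z + w) \<otimes> (c \<otimes> d)" using ca by (simp add: int_pow_mult)
  finally show ?case using generate.eng[OF h(1) k(1)] by blast
qed

text \<open>Division with remainder in a finitely generated abelian group, one generator at a time.\<close>

lemma generate_eq_power_mult_box:
  assumes "set as \<subseteq> carrier G" "b \<in> generate G (set as)" "m \<ge> 1"
    and comm: "\<And>b c. \<lbrakk>b \<in> generate G (set as); c \<in> generate G (set as)\<rbrakk> \<Longrightarrow> b \<otimes> c = c \<otimes> b"
  shows "\<exists>c\<in>generate G (set as). \<exists>r\<in>box as m. b = c [^] m \<otimes> r"
  using assms
proof (induction as arbitrary: b)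
  case Nil
  then show ?case by (simp add: generate_empty)
next
  case (Cons a as)
  let ?A = "generate G (set (a # as))"
  have sub: "subgroup ?A G" using Cons.prems(1) generate_is_subgroup by blast
  have mono: "generate G (set as) \<subseteq> ?A" by (rule mono_generate) auto
  have aA: "a \<in> ?A" by (simp add: generate.incl)
  have AC: "?A \<subseteq> carrier G" using subgroup.subset[OF sub] .
  obtain z c1 where z: "c1 \<in> generate G (set as)" "b = a [^] (z::int) \<otimes> c1"
    using generate_insert_commuting[of a "set as" b] Cons.prems by auto
  have "\<exists>c\<in>generate G (set as). \<exists>r\<in>box as m. c1 = c [^] m \<otimes> r"
  proof (rule Cons.IH)
    show "b \<otimes> c = c \<otimes> b" if "b \<in> generate G (set as)" "c \<in> generate G (set as)" for b c
      using that mono Cons.prems(4) by blast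
  qed (use Cons.prems z in auto)
  then obtain c r where cr: "c \<in> generate G (set as)" "r \<in> box as m" "c1 = c [^] m \<otimes> r" by blast
  have inA: "c \<in> ?A" "r \<in> ?A"
    using cr mono box_subset_generate[of as m] Cons.prems(1) by auto
  define u where "u = a [^] (z div int m)"
  define v where "v = a [^] (nat (z mod int m))"
  have uA: "u \<in> ?A" unfolding u_def using subgroup_int_pow_closed[OF sub aA] .
  have vA: "v \<in> ?A" unfolding v_def using nat_pow_in_subgroup[OF sub aA] .
  have cmA: "c [^] m \<in> ?A" using nat_pow_in_subgroup[OF sub inA(1)] .
  have car: "a \<in> carrier G" "u \<in> carrier G" "v \<in> carrier G" "c \<in> carrier G" "r \<in> carrier G"
    using aA uA vA inA AC by auto
  have "u [^] m \<otimes> v = a [^] (z div int m * int m) \<otimes> a [^] (z mod int m)"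
    using car(1) Cons.prems(3) int_pow_pow[OF car(1), of "z div int m" "int m"]
    by (simp add: u_def v_def int_pow_int pow_nat)
  also have "\<dots> = a [^] z" using car(1) by (simp add: int_pow_mult[symmetric])
  finally have uv: "u [^] m \<otimes> v = a [^] z" .
  have "(u \<otimes> c) [^] m \<otimes> (v \<otimes> r) = u [^] m \<otimes> (c [^] m \<otimes> v) \<otimes> r"
    using pow_mult_distrib[OF Cons.prems(4)[OF uA inA(1)], of m] car by (simp add: m_assoc)
  also have "\<dots> = (u [^] m \<otimes> v) \<otimes> (c [^] m \<otimes> r)"
    unfolding Cons.prems(4)[OF cmA vA] using car by (simp add: m_assoc)
  also have "\<dots> = b" using uv z cr by simp
  finally have "b = (u \<otimes> c) [^] m \<otimes> (v \<otimes> r)" by simp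
  moreover have "u \<otimes> c \<in> ?A" using subgroup.m_closed[OF sub uA inA(1)] .
  moreover have "nat (z mod int m) < m" using Cons.prems(3) by (simp add: nat_less_iff)
  then have "v \<otimes> r \<in> box (a # as) m" using cr(2) unfolding box.simps v_def by blast
  ultimately show ?case by blast
qed

end

context garside_order
begin

lemma box_subset_conj_ball:
  assumes A: "subgroup A G" "\<And>a b. \<lbrakk>a \<in> A; b \<in> A\<rbrakk> \<Longrightarrow> a \<otimes> b = b \<otimes> a"
    and "set as \<subseteq> A"
  shows "\<exists>K\<ge>0. \<forall>q. box as q \<subseteq> conj_ball A (int q * K)"
  using assms(3)
proof (induction as)
  case Nil
  have "box [] q \<subseteq> conj_ball A (int q * 0)" for q
    using subgroup.one_closed[OF A(1)] conj_sup_one by (simp add: conj_ball_def)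
  then show ?case by blast
next
  case (Cons a as)
  interpret A: subgroup A G by (rule A)
  obtain K where K: "K \<ge> 0" "\<And>q. box as q \<subseteq> conj_ball A (int q * K)" using Cons by auto
  define L where "L = max 0 (max (conj_sup a) (conj_sup (inv a)))"
  have aA: "a \<in> A" using Cons.prems by simp
  have pow_le: "conj_sup (c [^] n) \<le> int q * L"
    if "conj_sup c \<le> L" "c \<in> carrier G" "n < q" for c and n q :: nat
  proof -
    have "int n * conj_sup c \<le> int n * L" using that by (intro mult_left_mono) auto
    moreover have "int n * L \<le> int q * L" using that by (intro mult_right_mono) (auto simp: L_def)
    ultimately show ?thesis using conj_sup_pow[OF that(2), of n] by linarith
  qed
  have "box (a # as) q \<subseteq> conj_ball A (int q * (L + K))" for q
  proof
    fix g assume "g \<in> box (a # as) q"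
    then obtain n b where g: "n < q" "b \<in> box as q" "g = a [^] n \<otimes> b" by auto
    have b: "b \<in> A" "conj_sup b \<le> int q * K" "conj_sup (inv b) \<le> int q * K"
      using K(2)[of q] g(2) by (auto simp: conj_ball_def)
    have car: "a \<in> carrier G" "b \<in> carrier G" using aA b by auto
    have an: "a [^] n \<in> A" "inv a [^] n \<in> A" using nat_pow_in_subgroup[OF A(1)] aA by auto
    have "conj_sup g \<le> conj_sup (a [^] n) + conj_sup b"
      using conj_sup_mult[OF _ _ A(2)[OF an(1) b(1)]] g car by simp
    moreover have "inv g = inv b \<otimes> inv a [^] n"
      using g car by (simp add: inv_mult_group nat_pow_inv)
    then have "conj_sup (inv g) \<le> conj_sup (inv b) + conj_sup (inv a [^] n)"
      using conj_sup_mult[OF _ _ A(2)[OF _ an(2), of "inv b"]] b car by simp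
    moreover have "conj_sup (a [^] n) \<le> int q * L" "conj_sup (inv a [^] n) \<le> int q * L"
      using pow_le[of a n q] pow_le[of "inv a" n q] g(1) car by (simp_all add: L_def)
    moreover have "int q * (L + K) = int q * L + int q * K" by (simp add: distrib_left)
    ultimately have "conj_sup g \<le> int q * (L + K)" "conj_sup (inv g) \<le> int q * (L + K)"
      using b by linarith+
    then show "g \<in> conj_ball A (int q * (L + K))" using g an b by (simp add: conj_ball_def)
  qed
  moreover have "0 \<le> L + K" using K by (simp add: L_def)
  ultimately show ?case by blast
qed

text \<open>The \<open>q ^ length as\<close> elements of a box lie in a ball of radius proportional to \<open>q\<close>, which contains
  at most \<open>C * (q + 1) ^ card simples\<close> elements of the subgroup.\<close>

theorem rank_bound:
  assumes as: "set as \<subseteq> carrier G" "indep as"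
    and comm: "\<And>a b. \<lbrakk>a \<in> generate G (set as); b \<in> generate G (set as)\<rbrakk> \<Longrightarrow> a \<otimes> b = b \<otimes> a"
  shows "length as \<le> card simples"
proof (rule ccontr)
  assume long: "\<not> length as \<le> card simples"
  define A where "A = generate G (set as)"
  have A: "subgroup A G" using as generate_is_subgroup by (simp add: A_def)
  have cA: "a \<otimes> b = b \<otimes> a" if "a \<in> A" "b \<in> A" for a b using comm that by (simp add: A_def)
  obtain x where x: "x \<in> carrier G" "\<And>a. a \<in> A \<Longrightarrow> bounded_at x a (conj_sup a)"
    using optimal_base_point_ex[of "set as"] as comm unfolding A_def by auto
  have "set as \<subseteq> A" by (auto simp: A_def intro: generate.incl)
  then obtain K where K: "K \<ge> 0" "\<And>q. box as q \<subseteq> conj_ball A (int q * K)"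
    using box_subset_conj_ball[OF A cA] by blast
  define C where "C = card (ball_at \<one> 1) * card {z \<in> carrier G. shift x (- K) \<preceq> z \<and> z \<preceq> shift x K}"
  define n where "n = card simples"
  \<comment> \<open>Any \<open>q > C * 2 ^ n\<close> violates \<open>q ^ Suc n \<le> C * (2 * q) ^ n\<close>; the growth bound asks for \<open>q \<ge> 2\<close>.\<close>
  define q where "q = C * 2 ^ n + 2"
  have "optimal_flat G P D A x q"
    using A cA x by (intro optimal_flat.intro garside_order_axioms optimal_flat_axioms.intro)
      (auto simp: q_def)
  then have growth: "card (conj_ball A (int q * K)) \<le> C * (q + 1) ^ n"
    using optimal_flat.conj_ball_growth[of G P D A x q K] K(1) by (simp add: C_def n_def mult.assoc)
  have "q ^ n * q \<le> q ^ length as"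
    using long power_increasing[of "Suc n" "length as" q] by (simp add: q_def n_def mult.commute)
  also have "q ^ length as = card (box as q)" using card_box as by simp
  also have "\<dots> \<le> card (conj_ball A (int q * K))"
    using conj_ball_finite_card[OF A cA] K(2) by (intro card_mono) auto
  also have "\<dots> \<le> C * (2 * q) ^ n"
  proof -
    have "(q + 1) ^ n \<le> (2 * q) ^ n" by (intro power_mono) (auto simp: q_def)
    then show ?thesis using growth mult_left_mono[of "(q + 1) ^ n" "(2 * q) ^ n" C] by linarith
  qed
  also have "\<dots> = q ^ n * (C * 2 ^ n)" by (simp add: power_mult_distrib)
  finally have "q ^ n * q \<le> q ^ n * (C * 2 ^ n)" .
  then have "q \<le> C * 2 ^ n" by (simp add: q_def)
  then show False by (simp add: q_def)
qed

text \<open>Some power \<open>a\<^sup>m\<close> of each \<open>a \<in> A\<close> lies in the subgroup generated by a longest independent list.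
  Division with remainder by \<open>m\<close> replaces \<open>a\<close> by an element \<open>b\<close> of the same coset with \<open>b\<^sup>m\<close> in the box
  of size \<open>m\<close>. As \<open>conj_sup (b\<^sup>m) \<le> m * K\<close> implies \<open>conj_sup b \<le> K\<close> (\<open>conj_sup_root\<close>), these elements
  \<open>b\<close> belong to a finite ball that does not depend on \<open>m\<close>.\<close>

theorem abelian_subgroup_finitely_generated:
  assumes A: "subgroup A G" and comm: "\<And>a b. \<lbrakk>a \<in> A; b \<in> A\<rbrakk> \<Longrightarrow> a \<otimes> b = b \<otimes> a"
  shows "\<exists>S. finite S \<and> S \<subseteq> A \<and> generate G S = A"
proof -
  interpret A: subgroup A G by (rule A)
  define Q where "Q as \<longleftrightarrow> set as \<subseteq> A \<and> indep as" for as
  have gen_sub: "generate G S \<subseteq> A" if "S \<subseteq> A" for S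
    using generate_subgroup_incl[OF that A] .
  have len: "length as \<le> card simples" if "Q as" for as
    using rank_bound[of as] that gen_sub[of "set as"] comm A.subset unfolding Q_def by blast
  have "Q []" by (simp add: Q_def)
  then have "\<exists>as. Q as \<and> (\<forall>bs. Q bs \<longrightarrow> length bs \<le> length as)"
    by (rule ex_has_greatest_nat[where b = "Suc (card simples)"])
      (use len in \<open>auto simp: less_Suc_eq_le\<close>)
  then obtain as where as: "Q as" "\<And>bs. Q bs \<Longrightarrow> length bs \<le> length as" by auto
  have asA: "set as \<subseteq> A" "set as \<subseteq> carrier G" using as(1) A.subset by (auto simp: Q_def)
  obtain K where K: "K \<ge> 0" "\<And>q. box as q \<subseteq> conj_ball A (int q * K)"
    using box_subset_conj_ball[OF A comm asA(1)] by blast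
  define S where "S = set as \<union> conj_ball A K"
  have SA: "S \<subseteq> A" using asA by (auto simp: S_def conj_ball_def)
  have "a \<in> generate G S" if a: "a \<in> A" for a
  proof -
    have ac: "a \<in> carrier G" using a by simp
    have "\<not> Q (a # as)" using as(2)[of "a # as"] by auto
    then obtain m :: nat where m: "m \<ge> 1" "a [^] m \<in> generate G (set as)"
      using a as(1) by (auto simp: Q_def)
    obtain c r where c: "c \<in> generate G (set as)" and r: "r \<in> box as m" and eq: "a [^] m = c [^] m \<otimes> r"
      using generate_eq_power_mult_box[OF asA(2) m(2,1)] gen_sub[OF asA(1)] comm by blast
    have cA: "c \<in> A" using c gen_sub[OF asA(1)] by blast
    have rA: "r \<in> A" and rK: "conj_sup r \<le> int m * K" "conj_sup (inv r) \<le> int m * K"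
      using r K(2)[of m] by (auto simp: conj_ball_def)
    define b where "b = inv c \<otimes> a"
    have bA: "b \<in> A" and bc: "b \<in> carrier G" using cA a by (auto simp: b_def)
    have "b [^] m = inv c [^] m \<otimes> a [^] m"
      unfolding b_def using comm[of "inv c" a] cA a by (intro pow_mult_distrib) auto
    also have "\<dots> = r"
      using cA rA by (simp add: eq nat_pow_inv mult_inv_cancel_left)
    finally have bm: "b [^] m = r" .
    then have "inv b [^] m = inv r" using bc by (simp add: nat_pow_inv)
    then have "b \<in> conj_ball A K"
      using conj_sup_root[of b m K] conj_sup_root[of "inv b" m K] rK bm m bA bc
      by (simp add: conj_ball_def)
    then have "b \<in> generate G S" by (simp add: S_def generate.incl)
    moreover have "c \<in> generate G S"
      using c mono_generate[of "set as" S] by (auto simp: S_def)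
    moreover have "a = c \<otimes> b" using cA ac by (simp add: b_def mult_inv_cancel_left)
    ultimately show ?thesis by (simp add: generate.eng)
  qed
  then have "generate G S = A" using gen_sub[OF SA] by blast
  moreover have "finite S" using conj_ball_finite_card[OF A comm] by (simp add: S_def)
  ultimately show ?thesis using SA by blast
qed

end

section \<open>Solvable subgroups are virtually abelian\<close>

context group
begin

definition finite_index :: "'a set \<Rightarrow> 'a set \<Rightarrow> bool" where
  "finite_index K H \<longleftrightarrow> finite ((\<lambda>h. K #> h) ` H)"

lemma r_coset_eqI:
  assumes "subgroup K G" "h \<in> carrier G" "h' \<in> carrier G" "h' \<otimes> inv h \<in> K"
  shows "K #> h = K #> h'"
proof (rule repr_independence)
  have "h' = (h' \<otimes> inv h) \<otimes> h" using assms by (simp add: m_assoc)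
  then show "h' \<in> K #> h" using assms(4) unfolding r_coset_def by blast
qed (use assms in auto)

lemma finite_indexI:
  assumes "subgroup K G" "H \<subseteq> carrier G" "finite (f ` H)"
    and "\<And>h h'. \<lbrakk>h \<in> H; h' \<in> H; f h = f h'\<rbrakk> \<Longrightarrow> h' \<otimes> inv h \<in> K"
  shows "finite_index K H"
proof -
  obtain R where R: "R \<subseteq> H" "finite R" "f ` H = f ` R"
    using finite_subset_image[OF assms(3) subset_refl] by blast
  have "(\<lambda>h. K #> h) ` H \<subseteq> (\<lambda>h. K #> h) ` R"
  proof (rule image_subsetI)
    fix h assume h: "h \<in> H"
    then have "f h \<in> f ` R" using R(3) by blast
    then obtain r where r: "r \<in> R" "f h = f r" by blast
    then have "K #> h = K #> r" using h R(1) assms(2,4) by (intro r_coset_eqI assms(1)) auto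
    then show "K #> h \<in> (\<lambda>h. K #> h) ` R" using r by blast
  qed
  then show ?thesis unfolding finite_index_def by (rule finite_subset) (simp add: R(2))
qed

lemma finite_index_common_power:
  assumes K: "subgroup K G" and H: "subgroup H G" and fi: "finite_index K H"
  shows "\<exists>m::nat. m \<ge> 1 \<and> (\<forall>h\<in>H. h [^] m \<in> K)"
proof (intro exI conjI ballI)
  define c where "c = card ((\<lambda>h. K #> h) ` H)"
  \<comment> \<open>Two of the powers \<open>0, \<dots>, c\<close> of \<open>h\<close> lie in the same coset. The resulting exponent \<open>j - i\<close> depends
    on \<open>h\<close>; the factorial is a multiple of all of them.\<close>
  show "fact c \<ge> (1::nat)" by simp
  fix h assume h: "h \<in> H"
  have hc: "h \<in> carrier G" using h subgroup.subset[OF H] by blast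
  have "(\<lambda>i::nat. K #> h [^] i) ` {0..c} \<subseteq> (\<lambda>h. K #> h) ` H"
    using nat_pow_in_subgroup[OF H h] by blast
  then have "card ((\<lambda>i::nat. K #> h [^] i) ` {0..c}) \<le> c"
    using fi card_mono unfolding finite_index_def c_def by blast
  then have "\<not> inj_on (\<lambda>i::nat. K #> h [^] i) {0..c}" using card_image by fastforce
  then obtain i j where ij: "i < j" "j \<le> c" "K #> h [^] i = K #> h [^] j"
    unfolding inj_on_def by (metis atLeastAtMost_iff linorder_neqE_nat)
  have "h [^] j \<in> K #> h [^] i" using ij(3) rcos_self[OF _ K] hc by simp
  then obtain k where k: "k \<in> K" "h [^] j = k \<otimes> h [^] i" unfolding r_coset_def by blast
  have kc: "k \<in> carrier G" using k(1) subgroup.subset[OF K] by blast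
  have "h [^] (j - i) \<otimes> h [^] i = h [^] j" using hc ij(1) by (simp add: nat_pow_mult)
  then have "h [^] (j - i) = k" using k(2) hc kc by simp
  then have "h [^] (j - i) \<in> K" using k(1) by simp
  moreover have "j - i dvd fact c" using ij by (intro dvd_fact) auto
  then obtain e where "fact c = (j - i) * e" ..
  then have "h [^] (fact c :: nat) = (h [^] (j - i)) [^] e" using hc by (simp add: nat_pow_pow)
  ultimately show "h [^] (fact c :: nat) \<in> K" using nat_pow_in_subgroup[OF K] by simp
qed

lemma finite_box: "finite (box as q)"
proof (induction as)
  case (Cons a as)
  have "box (a # as) q = (\<lambda>(n, b). a [^] n \<otimes> b) ` ({..<q} \<times> box as q)" by auto
  then show ?case using Cons by (simp only:) simp
qed simp

lemma commutator_pow_right: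
  assumes "x \<in> carrier G" "y \<in> carrier G" "z \<in> carrier G"
    and "x \<otimes> y = z \<otimes> (y \<otimes> x)" "z \<otimes> y = y \<otimes> z"
  shows "x \<otimes> y [^] (q::nat) = z [^] q \<otimes> (y [^] q \<otimes> x)"
proof (induction q)
  case 0
  then show ?case using assms by simp
next
  case (Suc q)
  have yz: "y [^] q \<otimes> z = z \<otimes> y [^] q"
  proof (induction q)
    case (Suc q)
    then show ?case using assms by (metis m_assoc nat_pow_Suc nat_pow_closed)
  qed (use assms in simp)
  have "x \<otimes> y [^] Suc q = (x \<otimes> y [^] q) \<otimes> y" using assms by (simp add: m_assoc)
  also have "\<dots> = z [^] q \<otimes> (y [^] q \<otimes> (x \<otimes> y))" using Suc assms by (simp add: m_assoc)
  also have "\<dots> = z [^] q \<otimes> ((y [^] q \<otimes> z) \<otimes> (y \<otimes> x))" using assms by (simp add: m_assoc)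
  also have "\<dots> = z [^] Suc q \<otimes> (y [^] Suc q \<otimes> x)" unfolding yz using assms by (simp add: m_assoc)
  finally show ?case .
qed

lemma nat_pow_commute:
  assumes "x \<in> carrier G" "z \<in> carrier G" "z \<otimes> x = x \<otimes> z"
  shows "z [^] (q::nat) \<otimes> x = x \<otimes> z [^] q"
proof (induction q)
  case (Suc q)
  have "z [^] Suc q \<otimes> x = z [^] q \<otimes> (x \<otimes> z)" using assms by (simp add: m_assoc)
  also have "\<dots> = (z [^] q \<otimes> x) \<otimes> z" using assms by (simp add: m_assoc)
  also have "\<dots> = x \<otimes> z [^] Suc q" unfolding Suc using assms by (simp add: m_assoc)
  finally show ?case .
qed (use assms in simp)

lemma commutator_pow:
  assumes c: "x \<in> carrier G" "y \<in> carrier G" "z \<in> carrier G"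
    and "x \<otimes> y = z \<otimes> (y \<otimes> x)" "z \<otimes> x = x \<otimes> z" "z \<otimes> y = y \<otimes> z"
  shows "x [^] (p::nat) \<otimes> y [^] (q::nat) = z [^] (p * q) \<otimes> (y [^] q \<otimes> x [^] p)"
proof (induction p)
  case 0
  then show ?case using c by simp
next
  case (Suc p)
  have "x [^] Suc p \<otimes> y [^] q = x \<otimes> (x [^] p \<otimes> y [^] q)"
    using c by (simp add: nat_pow_Suc2 m_assoc del: nat_pow_Suc Group.nat_pow_Suc)
  also have "\<dots> = (x \<otimes> z [^] (p * q)) \<otimes> (y [^] q \<otimes> x [^] p)" unfolding Suc using c by (simp add: m_assoc)
  also have "\<dots> = z [^] (p * q) \<otimes> ((x \<otimes> y [^] q) \<otimes> x [^] p)"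
    unfolding nat_pow_commute[OF c(1,3) assms(5), symmetric] using c by (simp add: m_assoc)
  also have "\<dots> = (z [^] (p * q) \<otimes> z [^] q) \<otimes> (y [^] q \<otimes> (x \<otimes> x [^] p))"
    unfolding commutator_pow_right[OF c assms(4,6)] using c by (simp add: m_assoc)
  also have "\<dots> = z [^] (Suc p * q) \<otimes> (y [^] q \<otimes> x [^] Suc p)"
    using c by (simp add: nat_pow_mult nat_pow_Suc2 add.commute del: nat_pow_Suc Group.nat_pow_Suc)
  finally show ?case .
qed

end

context garside_order
begin

text \<open>A commutator \<open>z\<close> of \<open>x\<close> and \<open>y\<close> that commutes with both is quadratically distorted: the power
  \<open>p * n * n\<close> of \<open>z\<close> is the commutator of \<open>x [^] (p * n)\<close> and \<open>y [^] n\<close>, so its bounds grow linearly in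
  \<open>n\<close>, while those of the \<open>n * n\<close>-th power of an element \<open>g\<close> grow quadratically unless
  \<open>conj_sup g \<le> 1\<close>.\<close>

lemma conj_sup_central_commutator:
  assumes c: "x \<in> carrier G" "y \<in> carrier G" "z \<in> carrier G"
    and z: "x \<otimes> y = z \<otimes> (y \<otimes> x)" "z \<otimes> x = x \<otimes> z" "z \<otimes> y = y \<otimes> z"
  shows "conj_sup (z [^] (p::nat)) \<le> 1"
proof -
  have "\<exists>L::nat. L \<ge> 1 \<and> (\<forall>g\<in>{x, y, inv x, inv y}. bounded_at \<one> g (int L))"
  proof -
    have "\<forall>g\<in>{x, y, inv x, inv y}. \<exists>s. bounded_at \<one> g s" using bounded_at_ex c by blast
    then obtain s where s: "\<And>g. g \<in> {x, y, inv x, inv y} \<Longrightarrow> bounded_at \<one> g (s g)" by metis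
    define L where "L = nat (\<bar>s x\<bar> + \<bar>s y\<bar> + \<bar>s (inv x)\<bar> + \<bar>s (inv y)\<bar> + 1)"
    have "bounded_at \<one> g (int L)" if "g \<in> {x, y, inv x, inv y}" for g
      using that by (intro bounded_at_mono[OF s[OF that]]) (auto simp: L_def)
    moreover have "L \<ge> 1" by (simp add: L_def)
    ultimately show ?thesis by blast
  qed
  then obtain L :: nat where L: "L \<ge> 1" "\<And>g. g \<in> {x, y, inv x, inv y} \<Longrightarrow> bounded_at \<one> g (int L)"
    by blast
  \<comment> \<open>The product of \<open>2 * p * n + 2 * n\<close> factors bounded by \<open>L\<close> is then bounded by exactly \<open>n * n\<close>.\<close>
  define n where "n = (2 * p + 2) * L"
  have n1: "n * n \<ge> 1" using L(1) by (simp add: n_def)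
  have "x [^] (p * n) \<otimes> y [^] n = z [^] (p * n * n) \<otimes> (y [^] n \<otimes> x [^] (p * n))"
    using commutator_pow[OF c z] .
  then have "z [^] (p * n * n) = (x [^] (p * n) \<otimes> y [^] n) \<otimes> inv (y [^] n \<otimes> x [^] (p * n))"
    using c by (simp add: inv_solve_right)
  also have "\<dots> = (x [^] (p * n) \<otimes> y [^] n) \<otimes> (inv x [^] (p * n) \<otimes> inv y [^] n)"
    using c by (simp add: inv_mult_group nat_pow_inv)
  finally have zp: "z [^] (p * n * n) = (x [^] (p * n) \<otimes> y [^] n) \<otimes> (inv x [^] (p * n) \<otimes> inv y [^] n)" .
  have "bounded_at \<one> (z [^] (p * n * n))
    ((int (p * n) * int L + int n * int L) + (int (p * n) * int L + int n * int L))"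
    unfolding zp using L(2) by (intro bounded_at_mult bounded_at_pow) auto
  then have "bounded_at \<one> (z [^] (p * n * n)) (int (n * n) * 1)"
    by (rule bounded_at_mono) (simp add: n_def algebra_simps)
  moreover have "z [^] (p * n * n) = (z [^] p) [^] (n * n)"
    using c by (simp add: nat_pow_pow mult.assoc)
  ultimately have "conj_sup ((z [^] p) [^] (n * n)) \<le> int (n * n) * 1" using conj_sup_le by metis
  then show ?thesis using conj_sup_root[of "z [^] p" "n * n" 1] n1 c by simp
qed

text \<open>By the preceding lemma the powers of \<open>z\<close> and of \<open>inv z\<close> lie in one ball of the cyclic group
  generated by \<open>z\<close>. Balls are finite and the group is torsion-free.\<close>

lemma central_commutator_trivial:
  assumes c: "x \<in> carrier G" "y \<in> carrier G" "z \<in> carrier G"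
    and z: "x \<otimes> y = z \<otimes> (y \<otimes> x)" "z \<otimes> x = x \<otimes> z" "z \<otimes> y = y \<otimes> z"
  shows "z = \<one>"
proof -
  have zinv: "inv z \<otimes> g = g \<otimes> inv z" if "g \<in> carrier G" "z \<otimes> g = g \<otimes> z" for g
    using that c by (metis inv_closed inv_solve_left inv_solve_right m_assoc m_closed)
  have "y \<otimes> x = inv z \<otimes> (x \<otimes> y)" using c z by (simp add: mult_inv_cancel_left)
  then have neg: "conj_sup (inv z [^] p) \<le> 1" for p :: nat
    using conj_sup_central_commutator[of y x "inv z" p] c zinv z by simp
  have pos: "conj_sup (z [^] p) \<le> 1" for p :: nat
    using conj_sup_central_commutator[OF c z] .
  define A where "A = generate G {z}"
  have A: "subgroup A G" using generate_is_subgroup c by (simp add: A_def)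
  have comm: "a \<otimes> b = b \<otimes> a" if "a \<in> A" "b \<in> A" for a b
    using that generate_pow[OF c(3)] c(3) by (auto simp: A_def int_pow_mult[symmetric] add.commute)
  have zA: "z \<in> A" by (simp add: A_def generate.incl)
  have "range (\<lambda>p::nat. z [^] p) \<subseteq> conj_ball A 1"
    using nat_pow_in_subgroup[OF A zA] pos neg c by (auto simp: conj_ball_def nat_pow_inv[symmetric])
  then have "finite (range (\<lambda>p::nat. z [^] p))"
    using conj_ball_finite_card[OF A comm, of 1] finite_subset by blast
  then have "\<not> inj (\<lambda>p::nat. z [^] p)" using finite_imageD by blast
  then obtain i j :: nat where ij: "i < j" "z [^] i = z [^] j"
    unfolding inj_on_def by (metis linorder_neqE_nat)
  have "z [^] (j - i) \<otimes> z [^] i = z [^] j" using ij(1) c by (simp add: nat_pow_mult)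
  then have "z [^] (j - i) = \<one>" using ij(2) c by (metis nat_pow_closed r_cancel_one)
  then show ?thesis using torsion_free[of z "j - i"] ij c by simp
qed

definition virtually_abelian :: "'a set \<Rightarrow> bool" where
  "virtually_abelian H \<longleftrightarrow> (\<exists>K. subgroup K G \<and> K \<subseteq> H \<and> finite_index K H \<and>
    (\<forall>a\<in>K. \<forall>b\<in>K. a \<otimes> b = b \<otimes> a))"

text \<open>Division with remainder writes every element of \<open>K\<close> as an \<open>m\<close>-th power times an element of a
  finite box, and \<open>m\<close>-th powers disappear in the cosets of \<open>A\<close>.\<close>

lemma finite_index_power_generated:
  fixes m :: nat
  assumes N: "subgroup N G" and K: "subgroup K G" "K \<subseteq> N" "finite_index K N"
    and comm: "\<And>a b. \<lbrakk>a \<in> K; b \<in> K\<rbrakk> \<Longrightarrow> a \<otimes> b = b \<otimes> a"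
    and A: "subgroup A G" "\<And>n. n \<in> N \<Longrightarrow> n [^] m \<in> A" "m \<ge> 1"
  shows "finite_index A N"
proof -
  obtain S where S: "finite S" "S \<subseteq> K" "generate G S = K"
    using abelian_subgroup_finitely_generated[OF K(1) comm] by blast
  obtain ks where ks: "set ks = S" using finite_list[OF S(1)] by blast
  have NC: "N \<subseteq> carrier G" using subgroup.subset[OF N] .
  obtain R where R: "R \<subseteq> N" "finite R" "(\<lambda>h. K #> h) ` N = (\<lambda>h. K #> h) ` R"
    using finite_subset_image[OF K(3)[unfolded finite_index_def] subset_refl] by blast
  have "(\<lambda>h. A #> h) ` N \<subseteq> (\<lambda>(r, t). A #> (r \<otimes> t)) ` (box ks m \<times> R)"
  proof (rule image_subsetI)
    fix n assume n: "n \<in> N"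
    have nc: "n \<in> carrier G" using n NC by blast
    have "K #> n \<in> (\<lambda>h. K #> h) ` R" using n R(3) by blast
    then obtain t where t: "t \<in> R" "K #> n = K #> t" by blast
    have tc: "t \<in> carrier G" using t(1) R(1) NC by blast
    have "n \<in> K #> t" using t(2) rcos_self[OF nc K(1)] by simp
    then obtain k where k: "k \<in> K" "n = k \<otimes> t" unfolding r_coset_def by blast
    have "\<exists>c\<in>generate G (set ks). \<exists>r\<in>box ks m. k = c [^] m \<otimes> r"
    proof (rule generate_eq_power_mult_box)
      show "set ks \<subseteq> carrier G" using ks S(2) K(2) NC by blast
    qed (use k ks S(3) A(3) comm in auto)
    then obtain c r where c: "c \<in> K" "r \<in> box ks m" "k = c [^] m \<otimes> r" using ks S(3) by blast
    have rc: "r \<in> carrier G"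
    proof -
      have "set ks \<subseteq> carrier G" using ks S(2) K(2) NC by blast
      then have "r \<in> generate G (set ks)" using box_subset_generate[of ks m] c(2) by blast
      then show ?thesis using ks S(3) subgroup.subset[OF K(1)] by blast
    qed
    have cm: "c [^] m \<in> A" using A(2) c(1) K(2) by blast
    have cmc: "c [^] m \<in> carrier G" using cm subgroup.subset[OF A(1)] by blast
    have "A #> (r \<otimes> t) = A #> n"
    proof (rule r_coset_eqI[OF A(1)])
      have "n \<otimes> inv (r \<otimes> t) = c [^] m"
        using k c(3) cmc rc tc by (simp add: inv_mult_group m_assoc mult_inv_cancel_left)
      then show "n \<otimes> inv (r \<otimes> t) \<in> A" using cm by simp
    qed (use rc tc nc in auto)
    then show "A #> n \<in> (\<lambda>(r, t). A #> (r \<otimes> t)) ` (box ks m \<times> R)"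
      using c(2) t(1) by (intro image_eqI[of _ _ "(r, t)"]) auto
  qed
  then show ?thesis
    unfolding finite_index_def by (rule finite_subset) (simp add: finite_box R(2))
qed

text \<open>\<open>C\<close> is the set of elements of \<open>H\<close> that act trivially by conjugation both on \<open>A\<close> and on \<open>N / A\<close>. It
  has finite index because \<open>H\<close> has finitely many ways to act: \<open>N / A\<close> is finite, and as \<open>conj_sup\<close> is
  invariant under conjugation, a generator of \<open>A\<close> can only move within a finite ball of \<open>A\<close>.\<close>

lemma finite_index_centralizer_step:
  assumes H: "subgroup H G" and N: "subgroup N G" "N \<subseteq> H"
    and normal_N: "\<And>h n. \<lbrakk>h \<in> H; n \<in> N\<rbrakk> \<Longrightarrow> h \<otimes> n \<otimes> inv h \<in> N"
    and A: "subgroup A G" "A \<subseteq> N" "finite_index A N"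
    and comm_A: "\<And>a b. \<lbrakk>a \<in> A; b \<in> A\<rbrakk> \<Longrightarrow> a \<otimes> b = b \<otimes> a"
    and normal_A: "\<And>h a. \<lbrakk>h \<in> H; a \<in> A\<rbrakk> \<Longrightarrow> h \<otimes> a \<otimes> inv h \<in> A"
  defines "C \<equiv> {g \<in> H. (\<forall>a\<in>A. g \<otimes> a = a \<otimes> g) \<and> (\<forall>n\<in>N. \<exists>a\<in>A. g \<otimes> n = a \<otimes> (n \<otimes> g))}"
  shows "subgroup C G" "finite_index C H"
proof -
  interpret H: subgroup H G by (rule H)
  interpret A: subgroup A G by (rule A(1))
  interpret N: subgroup N G by (rule N(1))
  have CI: "g \<in> C" if "g \<in> H" "\<And>a. a \<in> A \<Longrightarrow> g \<otimes> a = a \<otimes> g"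
    "\<And>n. n \<in> N \<Longrightarrow> \<exists>a\<in>A. g \<otimes> n = a \<otimes> (n \<otimes> g)" for g
    using that by (simp add: C_def)
  show C: "subgroup C G"
  proof (rule subgroupI)
    show "C \<subseteq> carrier G" by (auto simp: C_def)
    have "\<one> \<in> C"
    proof (rule CI)
      fix n assume "n \<in> N"
      then have "\<one> \<otimes> n = \<one> \<otimes> (n \<otimes> \<one>)" by simp
      then show "\<exists>a\<in>A. \<one> \<otimes> n = a \<otimes> (n \<otimes> \<one>)" using A.one_closed by blast
    qed auto
    then show "C \<noteq> {}" by blast
  next
    fix g assume g: "g \<in> C"
    then have gH: "g \<in> H" "g \<in> carrier G" by (auto simp: C_def)
    have ga: "inv g \<otimes> a = a \<otimes> inv g" if "a \<in> A" for a
    proof -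
      have ac: "a \<in> carrier G" using that by simp
      have "g \<otimes> a = a \<otimes> g" using g that by (simp add: C_def)
      then have "inv g \<otimes> (g \<otimes> a) \<otimes> inv g = inv g \<otimes> (a \<otimes> g) \<otimes> inv g" by simp
      then show ?thesis using gH ac by (simp add: m_assoc mult_inv_cancel_left)
    qed
    show "inv g \<in> C"
    proof (rule CI)
      fix n assume n: "n \<in> N"
      obtain a where a: "a \<in> A" "g \<otimes> n = a \<otimes> (n \<otimes> g)" using g n by (auto simp: C_def)
      have ac: "a \<in> carrier G" "n \<in> carrier G" using a n by auto
      have "inv g \<otimes> (g \<otimes> n) \<otimes> inv g = inv g \<otimes> (a \<otimes> (n \<otimes> g)) \<otimes> inv g" using a(2) by simp
      then have "n \<otimes> inv g = (inv g \<otimes> a) \<otimes> n"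
        using gH ac by (simp add: m_assoc mult_inv_cancel_left)
      then have "n \<otimes> inv g = a \<otimes> (inv g \<otimes> n)" unfolding ga[OF a(1)] using gH ac by (simp add: m_assoc)
      then have "inv g \<otimes> n = inv a \<otimes> (n \<otimes> inv g)" using gH ac by (simp add: mult_inv_cancel_left)
      then show "\<exists>a\<in>A. inv g \<otimes> n = a \<otimes> (n \<otimes> inv g)" using a(1) by blast
    qed (use gH ga in auto)
  next
    fix g h assume gh: "g \<in> C" "h \<in> C"
    then have c: "g \<in> H" "h \<in> H" "g \<in> carrier G" "h \<in> carrier G" by (auto simp: C_def)
    show "g \<otimes> h \<in> C"
    proof (rule CI)
      fix a assume a: "a \<in> A"
      have ac: "a \<in> carrier G" using a by simp
      have "g \<otimes> a = a \<otimes> g" "h \<otimes> a = a \<otimes> h" using gh a by (auto simp: C_def)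
      then show "g \<otimes> h \<otimes> a = a \<otimes> (g \<otimes> h)" using c ac by (metis m_assoc)
    next
      fix n assume n: "n \<in> N"
      have nc: "n \<in> carrier G" using n by simp
      obtain a where a: "a \<in> A" "g \<otimes> n = a \<otimes> (n \<otimes> g)" using gh n by (auto simp: C_def)
      obtain b where b: "b \<in> A" "h \<otimes> n = b \<otimes> (n \<otimes> h)" using gh n by (auto simp: C_def)
      have ab: "a \<in> carrier G" "b \<in> carrier G" using a b by auto
      have gb: "g \<otimes> b = b \<otimes> g" using gh b by (auto simp: C_def)
      have "g \<otimes> h \<otimes> n = (g \<otimes> b) \<otimes> (n \<otimes> h)" using b(2) c nc ab by (simp add: m_assoc)
      also have "\<dots> = b \<otimes> (g \<otimes> n) \<otimes> h" unfolding gb using c nc ab by (simp add: m_assoc)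
      also have "\<dots> = (b \<otimes> a) \<otimes> (n \<otimes> (g \<otimes> h))" unfolding a(2) using c nc ab by (simp add: m_assoc)
      finally show "\<exists>a\<in>A. g \<otimes> h \<otimes> n = a \<otimes> (n \<otimes> (g \<otimes> h))" using a b by blast
    qed (use c in auto)
  qed
  obtain S where S: "finite S" "S \<subseteq> A" "generate G S = A"
    using abelian_subgroup_finitely_generated[OF A(1) comm_A] by blast
  obtain T where T: "T \<subseteq> N" "finite T" "(\<lambda>h. A #> h) ` N = (\<lambda>h. A #> h) ` T"
    using finite_subset_image[OF A(3)[unfolded finite_index_def] subset_refl] by blast
  define action where "action h =
    (restrict (\<lambda>s. inv h \<otimes> s \<otimes> h) S, restrict (\<lambda>t. A #> (inv h \<otimes> t \<otimes> h)) T)" for h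
  have inv_conj: "inv h \<otimes> y \<otimes> h \<in> Y" if "h \<in> H" "y \<in> Y"
    "\<And>h y. \<lbrakk>h \<in> H; y \<in> Y\<rbrakk> \<Longrightarrow> h \<otimes> y \<otimes> inv h \<in> Y" for h y Y
    using that(3)[of "inv h" y] that(1,2) by simp
  show "finite_index C H"
  proof (rule finite_indexI[where f = action])
    have "action ` H \<subseteq> PiE S (\<lambda>s. conj_ball A (max (conj_sup s) (conj_sup (inv s))))
        \<times> PiE T (\<lambda>_. (\<lambda>h. A #> h) ` N)"
    proof (rule image_subsetI)
      fix h assume h: "h \<in> H"
      have "inv h \<otimes> s \<otimes> h \<in> conj_ball A (max (conj_sup s) (conj_sup (inv s)))" if s: "s \<in> S" for s
      proof -
        have sA: "s \<in> A" and sc: "s \<in> carrier G" using s S(2) by auto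
        have hc: "h \<in> carrier G" using h by simp
        have "inv (inv h \<otimes> s \<otimes> h) = inv h \<otimes> inv s \<otimes> h"
          using hc sc by (simp add: inv_mult_group m_assoc)
        moreover have "conj_sup (inv h \<otimes> s \<otimes> h) \<le> conj_sup s"
          "conj_sup (inv h \<otimes> inv s \<otimes> h) \<le> conj_sup (inv s)"
          using conj_sup_conjugate_le[of s "inv h"] conj_sup_conjugate_le[of "inv s" "inv h"] hc sc
          by simp_all
        ultimately show ?thesis
          using inv_conj[OF h sA normal_A]
          by (simp add: conj_ball_def max.coboundedI1 max.coboundedI2)
      qed
      moreover have "A #> (inv h \<otimes> t \<otimes> h) \<in> (\<lambda>h. A #> h) ` N" if "t \<in> T" for t
        using inv_conj[OF h _ normal_N, of t] that T(1) by blast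
      ultimately show "action h \<in> PiE S (\<lambda>s. conj_ball A (max (conj_sup s) (conj_sup (inv s))))
        \<times> PiE T (\<lambda>_. (\<lambda>h. A #> h) ` N)"
        unfolding action_def by (intro SigmaI restrict_PiE_iff[THEN iffD2] ballI) auto
    qed
    moreover have "finite (conj_ball A r)" for r
      using conj_ball_finite_card[OF A(1) comm_A, of r] by simp
    then have "finite (PiE S (\<lambda>s. conj_ball A (max (conj_sup s) (conj_sup (inv s))))
        \<times> PiE T (\<lambda>_. (\<lambda>h. A #> h) ` N))"
      using S(1) T(2) A(3) unfolding finite_index_def by (intro finite_cartesian_product finite_PiE) auto
    ultimately show "finite (action ` H)" by (rule finite_subset)
  next
    fix h h' assume h: "h \<in> H" "h' \<in> H" and eq: "action h = action h'"
    have hc: "h \<in> carrier G" "h' \<in> carrier G" using h by auto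
    define g where "g = h' \<otimes> inv h"
    have gH: "g \<in> H" and gc: "g \<in> carrier G" using h by (auto simp: g_def)
    have gs: "g \<otimes> s = s \<otimes> g" if s: "s \<in> S" for s
    proof -
      have sc: "s \<in> carrier G" using s S(2) by auto
      have "fst (action h) s = fst (action h') s" using eq by simp
      then have "inv h \<otimes> s \<otimes> h = inv h' \<otimes> s \<otimes> h'" using s by (simp add: action_def)
      then have "h' \<otimes> (inv h \<otimes> s \<otimes> h) \<otimes> inv h = h' \<otimes> (inv h' \<otimes> s \<otimes> h') \<otimes> inv h" by simp
      then show ?thesis using hc sc by (simp add: g_def m_assoc mult_inv_cancel_left)
    qed
    have ga: "g \<otimes> a = a \<otimes> g" if "a \<in> A" for a
      using that[folded S(3)]
    proof (induction rule: generate.induct)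
      case (inv s)
      have sc: "s \<in> carrier G" using inv S(2) by auto
      have "inv s \<otimes> (g \<otimes> s) \<otimes> inv s = inv s \<otimes> (s \<otimes> g) \<otimes> inv s" using gs[OF inv] by simp
      then show ?case using sc gc by (simp add: m_assoc mult_inv_cancel_left)
    next
      case (eng a b)
      have "a \<in> carrier G" "b \<in> carrier G" using eng(1,2) S(3) by auto
      then show ?case using eng(3,4) gc by (metis m_assoc)
    qed (use gs gc in auto)
    show "h' \<otimes> inv h \<in> C"
      unfolding g_def[symmetric]
    proof (rule CI[OF gH ga])
      fix n assume n: "n \<in> N"
      have nc: "n \<in> carrier G" using n by simp
      have "A #> n \<in> (\<lambda>h. A #> h) ` T" using n T(3) by blast
      then obtain t where t: "t \<in> T" "A #> n = A #> t" by blast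
      have tc: "t \<in> carrier G" using t(1) T(1) by auto
      have "n \<in> A #> t" using t(2) rcos_self[OF nc A(1)] by simp
      then obtain a0 where a0: "a0 \<in> A" "n = a0 \<otimes> t" unfolding r_coset_def by blast
      have "snd (action h) t = snd (action h') t" using eq by simp
      then have "A #> (inv h \<otimes> t \<otimes> h) = A #> (inv h' \<otimes> t \<otimes> h')" using t(1) by (simp add: action_def)
      then have "inv h' \<otimes> t \<otimes> h' \<in> A #> (inv h \<otimes> t \<otimes> h)"
        using rcos_self[OF _ A(1), of "inv h' \<otimes> t \<otimes> h'"] hc tc by simp
      then obtain a1 where a1: "a1 \<in> A" "inv h' \<otimes> t \<otimes> h' = a1 \<otimes> (inv h \<otimes> t \<otimes> h)"
        unfolding r_coset_def by blast
      define a2 where "a2 = h' \<otimes> a1 \<otimes> inv h'"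
      have a2: "a2 \<in> A" using normal_A[OF h(2) a1(1)] by (simp add: a2_def)
      have ac: "a0 \<in> carrier G" "a1 \<in> carrier G" "a2 \<in> carrier G" using a0 a1 a2 by auto
      have "h' \<otimes> (inv h' \<otimes> t \<otimes> h') \<otimes> inv h = h' \<otimes> (a1 \<otimes> (inv h \<otimes> t \<otimes> h)) \<otimes> inv h"
        using a1(2) by simp
      then have "t \<otimes> g = a2 \<otimes> (g \<otimes> t)"
        using hc tc ac(2) by (simp add: g_def a2_def m_assoc mult_inv_cancel_left)
      then have gt: "g \<otimes> t = inv a2 \<otimes> (t \<otimes> g)" using ac gc tc by (simp add: mult_inv_cancel_left)
      have "g \<otimes> n = (g \<otimes> a0) \<otimes> t" using a0(2) ac gc tc by (simp add: m_assoc)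
      also have "\<dots> = a0 \<otimes> (g \<otimes> t)" unfolding ga[OF a0(1)] using ac gc tc by (simp add: m_assoc)
      also have "\<dots> = (a0 \<otimes> inv a2) \<otimes> (t \<otimes> g)" unfolding gt using ac gc tc by (simp add: m_assoc)
      also have "a0 \<otimes> inv a2 = inv a2 \<otimes> a0" using comm_A a0(1) a2 by simp
      also have "inv a2 \<otimes> a0 \<otimes> (t \<otimes> g) = inv a2 \<otimes> (n \<otimes> g)"
        using a0(2) ac gc tc by (simp add: m_assoc)
      finally show "\<exists>a\<in>A. g \<otimes> n = a \<otimes> (n \<otimes> g)" using a2 by blast
    qed
  qed (use C H.subset in auto)
qed

text \<open>An abelian subgroup \<open>K\<close> of finite index in \<open>N\<close> need not be normal in \<open>H\<close>. For a suitable \<open>m\<close>, the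
  subgroup \<open>A\<close> generated by the \<open>m\<close>-th powers of elements of \<open>N\<close> is contained in \<open>K\<close>, normal in \<open>H\<close> and
  still of finite index in \<open>N\<close>. Let \<open>C\<close> be the finite-index subgroup of the preceding lemma. A
  commutator of an element of \<open>C\<close> with one of \<open>C \<inter> N\<close> lies in \<open>A\<close>, hence commutes with both and is
  trivial. A commutator of two elements of \<open>C\<close> lies in \<open>C \<inter> N\<close>, hence commutes with both by
  the first step and is trivial as well.\<close>

theorem virtually_abelian_extension:
  assumes H: "subgroup H G" and N: "subgroup N G" "N \<subseteq> H"
    and normal_N: "\<And>h n. \<lbrakk>h \<in> H; n \<in> N\<rbrakk> \<Longrightarrow> h \<otimes> n \<otimes> inv h \<in> N"
    and abelian_quotient: "\<And>x y. \<lbrakk>x \<in> H; y \<in> H\<rbrakk> \<Longrightarrow> x \<otimes> y \<otimes> inv (y \<otimes> x) \<in> N"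
    and va: "virtually_abelian N"
  shows "virtually_abelian H"
proof -
  obtain K where K: "subgroup K G" "K \<subseteq> N" "finite_index K N"
    and comm: "\<And>a b. \<lbrakk>a \<in> K; b \<in> K\<rbrakk> \<Longrightarrow> a \<otimes> b = b \<otimes> a"
    using va unfolding virtually_abelian_def by blast
  obtain m :: nat where m: "m \<ge> 1" "\<And>n. n \<in> N \<Longrightarrow> n [^] m \<in> K"
    using finite_index_common_power[OF K(1) N(1) K(3)] by blast
  interpret H: subgroup H G by (rule H)
  interpret N: subgroup N G by (rule N(1))
  define W where "W = (\<lambda>n. n [^] m) ` N"
  define A where "A = generate G W"
  have WK: "W \<subseteq> K" using m(2) by (auto simp: W_def)
  have AK: "A \<subseteq> K" unfolding A_def using generate_subgroup_incl[OF WK K(1)] .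
  have WC: "W \<subseteq> carrier G" by (auto simp: W_def)
  have A: "subgroup A G" unfolding A_def using generate_is_subgroup[OF WC] .
  have comm_A: "a \<otimes> b = b \<otimes> a" if "a \<in> A" "b \<in> A" for a b using comm that AK by blast
  have WA: "n [^] m \<in> A" if "n \<in> N" for n
    using that by (auto simp: A_def W_def intro: generate.incl)
  have conj_W: "h \<otimes> y \<otimes> inv h \<in> W" if "h \<in> H" "y \<in> W" for h y
  proof -
    obtain n where n: "n \<in> N" "y = n [^] m" using \<open>y \<in> W\<close> by (auto simp: W_def)
    have c: "h \<in> carrier G" "n \<in> carrier G" using that n by auto
    have "(h \<otimes> n \<otimes> inv h) [^] k = h \<otimes> n [^] k \<otimes> inv h" for k :: nat
    proof (induction k)
      case (Suc k)
      then show ?case using c by (simp add: m_assoc mult_inv_cancel_left)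
    qed (use c in simp)
    from this[of m] show ?thesis using normal_N[OF that(1) n(1)] n(2) unfolding W_def by (metis imageI)
  qed
  have normal_A: "h \<otimes> a \<otimes> inv h \<in> A" if h: "h \<in> H" and a: "a \<in> A" for h a
    using a unfolding A_def
  proof (induction rule: generate.induct)
    case one
    then show ?case using h generate.one by simp
  next
    case (incl y)
    then show ?case using conj_W h by (simp add: generate.incl)
  next
    case (inv y)
    have "h \<otimes> inv y \<otimes> inv h = inv (h \<otimes> y \<otimes> inv h)"
      using h inv WC by (simp add: inv_mult_group m_assoc subset_iff)
    then show ?case using conj_W[OF h inv] by (simp add: generate.inv)
  next
    case (eng a b)
    have c: "a \<in> carrier G" "b \<in> carrier G"
      using eng(1,2) generate_in_carrier[OF WC] by auto
    have "h \<otimes> (a \<otimes> b) \<otimes> inv h = (h \<otimes> a \<otimes> inv h) \<otimes> (h \<otimes> b \<otimes> inv h)"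
      using c h by (simp add: m_assoc mult_inv_cancel_left)
    then show ?case using eng(3,4) by (simp add: generate.eng)
  qed
  have AN: "A \<subseteq> N" using AK K(2) by blast
  have fiA: "finite_index A N"
    using finite_index_power_generated[OF N(1) K comm A WA m(1)] .
  define C where "C = {g \<in> H. (\<forall>a\<in>A. g \<otimes> a = a \<otimes> g) \<and> (\<forall>n\<in>N. \<exists>a\<in>A. g \<otimes> n = a \<otimes> (n \<otimes> g))}"
  have C: "subgroup C G" "finite_index C H"
    using finite_index_centralizer_step[OF H N normal_N A AN fiA comm_A normal_A]
    unfolding C_def by blast+
  interpret C: subgroup C G by (rule C(1))
  have CN: "x \<otimes> c = c \<otimes> x" if x: "x \<in> C" and c: "c \<in> C" "c \<in> N" for x c
  proof -
    obtain a where a: "a \<in> A" "x \<otimes> c = a \<otimes> (c \<otimes> x)" using x c by (auto simp: C_def)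
    have "a \<otimes> x = x \<otimes> a" "a \<otimes> c = c \<otimes> a" using x c(1) a(1) by (auto simp: C_def)
    moreover have car: "x \<in> carrier G" "c \<in> carrier G" "a \<in> carrier G"
      using x c subgroup.subset[OF A] a by auto
    ultimately have "a = \<one>" using central_commutator_trivial[OF car a(2)] by blast
    then show ?thesis using a(2) car by simp
  qed
  have "x \<otimes> y = y \<otimes> x" if xy: "x \<in> C" "y \<in> C" for x y
  proof -
    define z where "z = x \<otimes> y \<otimes> inv (y \<otimes> x)"
    have car: "x \<in> carrier G" "y \<in> carrier G" using xy by auto
    have zC: "z \<in> C" using xy by (simp add: z_def)
    have zN: "z \<in> N" using abelian_quotient xy unfolding z_def C_def by blast
    have eq: "x \<otimes> y = z \<otimes> (y \<otimes> x)" using car by (simp add: z_def m_assoc)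
    have zc: "z \<in> carrier G" using zC by simp
    have "z = \<one>"
      using central_commutator_trivial[OF car zc eq] CN[OF xy(1) zC zN] CN[OF xy(2) zC zN] by simp
    then show ?thesis using eq car by simp
  qed
  moreover have "C \<subseteq> H" by (auto simp: C_def)
  ultimately show ?thesis using C unfolding virtually_abelian_def by blast
qed

lemma solvable_imp_virtually_abelian:
  assumes H: "subgroup H G" and "solvable (G\<lparr>carrier := H\<rparr>)"
  shows "virtually_abelian H"
proof -
  have grp: "group (G\<lparr>carrier := H\<rparr>)" using subgroup.subgroup_is_group[OF H is_group] .
  have "subgroup L G \<and> virtually_abelian L" if "solvable_seq (G\<lparr>carrier := H\<rparr>) L" for L
    using that
  proof (induction rule: solvable_seq.induct)
    case unity
    have "finite_index {\<one>} {\<one>}" by (simp add: finite_index_def)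
    then have "virtually_abelian {\<one>}"
      unfolding virtually_abelian_def using triv_subgroup by blast
    then show ?case using triv_subgroup by simp
  next
    case (extension N L)
    have L: "subgroup L G" using incl_subgroup[OF H extension(3)] .
    have N: "subgroup N G" "virtually_abelian N" using extension by auto
    have nrm: "N \<lhd> G\<lparr>carrier := L\<rparr>" using extension(2) by simp
    interpret nrm: normal N "G\<lparr>carrier := L\<rparr>" by (rule nrm)
    interpret Q: comm_group "G\<lparr>carrier := L\<rparr> Mod N" using extension(4) by simp
    have NL: "N \<subseteq> L" using nrm.subset by simp
    have LC: "L \<subseteq> carrier G" using subgroup.subset[OF L] .
    have "virtually_abelian L"
    proof (rule virtually_abelian_extension[OF L N(1) NL _ _ N(2)])
      fix h n assume hn: "h \<in> L" "n \<in> N"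
      show "h \<otimes> n \<otimes> inv h \<in> N"
        using nrm.inv_op_closed2[of h n] hn m_inv_consistent[OF L, of h] by simp
    next
      fix x y assume xy: "x \<in> L" "y \<in> L"
      have coset: "N #>\<^bsub>G\<lparr>carrier := L\<rparr>\<^esub> z = N #> z" for z
        by (simp add: r_coset_def)
      have mem: "N #>\<^bsub>G\<lparr>carrier := L\<rparr>\<^esub> z \<in> carrier (G\<lparr>carrier := L\<rparr> Mod N)" if "z \<in> L" for z
        using that by (auto simp: FactGroup_def RCOSETS_def)
      have "N #> (x \<otimes> y) = N #> (y \<otimes> x)"
        using Q.m_comm[OF mem[OF xy(1)] mem[OF xy(2)]] nrm.rcos_sum[of x y] nrm.rcos_sum[of y x] xy
        by (simp add: FactGroup_def coset)
      moreover have "x \<otimes> y \<in> carrier G" "y \<otimes> x \<in> carrier G" using xy LC by auto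
      ultimately have "x \<otimes> y \<in> N #> (y \<otimes> x)" using rcos_self[OF _ N(1)] by metis
      then obtain n where n: "n \<in> N" "x \<otimes> y = n \<otimes> (y \<otimes> x)" unfolding r_coset_def by blast
      then show "x \<otimes> y \<otimes> inv (y \<otimes> x) \<in> N"
        using xy LC NL by (simp add: inv_solve_right subset_iff m_assoc)
    qed
    then show ?case using L by simp
  qed
  then show ?thesis using assms(2) unfolding solvable_def by simp
qed

theorem solvable_imp_virtually_fg_abelian:
  assumes H: "subgroup H G" and "solvable (G\<lparr>carrier := H\<rparr>)"
  shows "virtually (\<lambda>A. comm_group A \<and> finitely_generated A) (G\<lparr>carrier := H\<rparr>)"
proof -
  obtain K where K: "subgroup K G" "K \<subseteq> H" "finite_index K H"
    and comm: "\<And>a b. \<lbrakk>a \<in> K; b \<in> K\<rbrakk> \<Longrightarrow> a \<otimes> b = b \<otimes> a"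
    using solvable_imp_virtually_abelian[OF assms] unfolding virtually_abelian_def by blast
  have "rcosets\<^bsub>G\<lparr>carrier := H\<rparr>\<^esub> K = (\<lambda>h. K #> h) ` H"
    by (auto simp: RCOSETS_def r_coset_def)
  then have "finite (rcosets\<^bsub>G\<lparr>carrier := H\<rparr>\<^esub> K)" using K(3) by (simp add: finite_index_def)
  moreover have "subgroup K (G\<lparr>carrier := H\<rparr>)" using subgroup_incl[OF K(1) H K(2)] .
  moreover have "comm_group (G\<lparr>carrier := K\<rparr>)"
    using group.group_comm_groupI[OF subgroup.subgroup_is_group[OF K(1) is_group]] comm by simp
  moreover obtain S where S: "finite S" "S \<subseteq> K" "generate G S = K"
    using abelian_subgroup_finitely_generated[OF K(1) comm] by blast
  then have "finitely_generated (G\<lparr>carrier := K\<rparr>)"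
    using generate_consistent[OF S(2) K(1)] unfolding finitely_generated_def by auto
  ultimately show ?thesis unfolding virtually_def by auto
qed

end

section \<open>The order on the group of fractions\<close>

context Garside_monoid
begin

abbreviation list_product :: "'a list \<Rightarrow> 'a" where
  "list_product xs \<equiv> foldr (\<otimes>) xs \<one>"

lemma generates_monoid_induct [consumes 2, case_names generator one mult]:
  assumes "generates_monoid M S" "m \<in> carrier M"
    and "\<And>s. s \<in> S \<Longrightarrow> s \<in> carrier M \<Longrightarrow> Q s" and "Q \<one>"
    and "\<And>a b. \<lbrakk>a \<in> carrier M; b \<in> carrier M; Q a; Q b\<rbrakk> \<Longrightarrow> Q (a \<otimes> b)"
  shows "Q m"
proof -
  have S: "S \<subseteq> carrier M" and hull: "(\<lambda>N. submonoid N M) hull S = carrier M"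
    using assms(1) by (auto simp: generates_monoid_def)
  have "submonoid {x \<in> carrier M. Q x} M" using assms(4,5) by (intro submonoid.intro) auto
  moreover have "S \<subseteq> {x \<in> carrier M. Q x}" using S assms(3) by auto
  ultimately have "(\<lambda>N. submonoid N M) hull S \<subseteq> {x \<in> carrier M. Q x}" by (rule hull_minimal[rotated])
  then show ?thesis using hull assms(2) by auto
qed

lemma indivisible_in_generators:
  assumes "generates_monoid M S" "indivisible M x"
  shows "x \<in> S"
proof (rule ccontr)
  assume x: "x \<notin> S"
  have "y \<noteq> x" if "y \<in> carrier M" for y
    using assms(1) that
  proof (induction rule: generates_monoid_induct)
    case (mult a b)
    then show ?case using assms(2) unfolding indivisible_def by (metis l_one r_one)
  qed (use x assms(2) in \<open>auto simp: indivisible_def\<close>)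
  then show False using assms(2) by (auto simp: indivisible_def)
qed

lemma list_product_closed: "set xs \<subseteq> carrier M \<Longrightarrow> list_product xs \<in> carrier M"
  by (induction xs) auto

lemma list_product_append:
  "\<lbrakk>set xs \<subseteq> carrier M; set ys \<subseteq> carrier M\<rbrakk> \<Longrightarrow> list_product (xs @ ys) = list_product xs \<otimes> list_product ys"
  by (induction xs) (auto simp: list_product_closed m_assoc)

lemma indivisible_factorization_ex:
  assumes "m \<in> carrier M"
  shows "\<exists>xs. set xs \<subseteq> Collect (indivisible M) \<and> list_product xs = m"
  using indivisibles_generate assms
proof (induction rule: generates_monoid_induct)
  case (generator s)
  then show ?case by (intro exI[of _ "[s]"]) auto
next
  case one
  then show ?case by (intro exI[of _ "[]"]) auto
next
  case (mult a b)
  then obtain xs ys where "set xs \<subseteq> Collect (indivisible M)" "list_product xs = a"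
    "set ys \<subseteq> Collect (indivisible M)" "list_product ys = b" by blast
  moreover have "Collect (indivisible M) \<subseteq> carrier M" by (auto simp: indivisible_def)
  ultimately show ?case
    using list_product_append[of xs ys] by (intro exI[of _ "xs @ ys"]) auto
qed

lemma factorization_length_bound:
  assumes "m \<in> carrier M"
  shows "\<exists>k. \<forall>xs. set xs \<subseteq> Collect (indivisible M) \<longrightarrow> list_product xs = m \<longrightarrow> length xs \<le> k"
proof -
  obtain k where k: "mnorm M m = enat k" using mnorm_finite[OF assms] by auto
  have "length xs \<le> k" if "set xs \<subseteq> Collect (indivisible M)" "list_product xs = m" for xs
  proof -
    have "enat (length xs) \<le> mnorm M m"
      unfolding mnorm_def using that by (intro SUP_upper) auto
    then show ?thesis using k by simp
  qed
  then show ?thesis by blast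
qed

text \<open>A nontrivial factorization of \<open>\<one>\<close> could be repeated to give arbitrarily long expressions of \<open>\<one>\<close>.\<close>

lemma no_units:
  assumes "a \<in> carrier M" "b \<in> carrier M" "a \<otimes> b = \<one>"
  shows "a = \<one>"
proof (rule ccontr)
  assume a: "a \<noteq> \<one>"
  let ?I = "Collect (indivisible M)"
  have IC: "?I \<subseteq> carrier M" by (auto simp: indivisible_def)
  obtain xs where xs: "set xs \<subseteq> ?I" "list_product xs = a" using indivisible_factorization_ex assms by blast
  obtain ys where ys: "set ys \<subseteq> ?I" "list_product ys = b" using indivisible_factorization_ex assms by blast
  have "xs \<noteq> []" using xs a by auto
  then have len: "length (xs @ ys) \<ge> 1" by (cases xs) auto
  have zs: "set (xs @ ys) \<subseteq> ?I" "list_product (xs @ ys) = \<one>"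
    using list_product_append[of xs ys] xs ys IC assms by auto
  have rep: "set (concat (replicate n (xs @ ys))) \<subseteq> ?I \<and>
      list_product (concat (replicate n (xs @ ys))) = \<one> \<and> n \<le> length (concat (replicate n (xs @ ys)))" for n
  proof (induction n)
    case (Suc n)
    let ?c = "concat (replicate n (xs @ ys))"
    have "list_product ((xs @ ys) @ ?c) = list_product (xs @ ys) \<otimes> list_product ?c"
      using zs(1) Suc IC by (intro list_product_append) blast+
    then have "list_product ((xs @ ys) @ ?c) = \<one>" using zs(2) Suc by simp
    then show ?case using zs(1) Suc len by auto
  qed simp
  obtain k where k: "\<forall>xs. set xs \<subseteq> ?I \<longrightarrow> list_product xs = \<one> \<longrightarrow> length xs \<le> k"
    using factorization_length_bound[of \<one>] by auto
  have "Suc k \<le> k" using rep[of "Suc k"] k le_trans by blast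
  then show False by simp
qed

text \<open>The indivisible elements are finite in number, since every generating set contains them, and the
  expressions of a divisor of \<open>m\<close> are no longer than the longest expression of \<open>m\<close>.\<close>

lemma finite_divisors:
  assumes "m \<in> carrier M"
  shows "finite {p \<in> carrier M. \<exists>c\<in>carrier M. m = p \<otimes> c}"
proof -
  let ?I = "Collect (indivisible M)"
  have IC: "?I \<subseteq> carrier M" by (auto simp: indivisible_def)
  have "?I \<subseteq> left_divisors M \<Delta>" using indivisible_in_generators[OF simple_divisors_generate] by blast
  then have finI: "finite ?I" using finite_simple_divisors finite_subset by blast
  obtain k where k: "\<And>xs. set xs \<subseteq> ?I \<Longrightarrow> list_product xs = m \<Longrightarrow> length xs \<le> k"
    using factorization_length_bound[OF assms] by blast
  have "{p \<in> carrier M. \<exists>c\<in>carrier M. m = p \<otimes> c} \<subseteq> list_product ` {xs. set xs \<subseteq> ?I \<and> length xs \<le> k}"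
  proof
    fix p assume "p \<in> {p \<in> carrier M. \<exists>c\<in>carrier M. m = p \<otimes> c}"
    then obtain c where pc: "p \<in> carrier M" "c \<in> carrier M" "m = p \<otimes> c" by blast
    obtain xs where xs: "set xs \<subseteq> ?I" "list_product xs = p" using indivisible_factorization_ex pc by blast
    obtain ys where ys: "set ys \<subseteq> ?I" "list_product ys = c" using indivisible_factorization_ex pc by blast
    have "list_product (xs @ ys) = m" using list_product_append[of xs ys] xs ys pc IC by auto
    then have "length (xs @ ys) \<le> k" using xs ys by (intro k) auto
    then have "xs \<in> {xs. set xs \<subseteq> ?I \<and> length xs \<le> k}" using xs by simp
    then show "p \<in> list_product ` {xs. set xs \<subseteq> ?I \<and> length xs \<le> k}" using xs(2) by blast
  qed
  then show ?thesis using finite_lists_length_le[OF finI] finite_subset by blast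
qed

text \<open>If \<open>\<Delta> = s \<otimes> c\<close>, then \<open>c\<close> is a right divisor of \<open>\<Delta>\<close>, hence a left divisor, say \<open>\<Delta> = c \<otimes> c'\<close>,
  and so \<open>s \<otimes> \<Delta> = s \<otimes> c \<otimes> c' = \<Delta> \<otimes> c'\<close>.\<close>

lemma Delta_conjugates_right:
  assumes "m \<in> carrier M"
  shows "\<exists>m'\<in>carrier M. m \<otimes> \<Delta> = \<Delta> \<otimes> m'"
  using simple_divisors_generate assms
proof (induction rule: generates_monoid_induct)
  case (generator s)
  then obtain c where c: "c \<in> carrier M" "\<Delta> = s \<otimes> c" by (auto simp: left_divisors_def factor_def)
  then have "c \<in> left_divisors M \<Delta>"
    unfolding left_divisors_eq_right_divisors right_divisors_iff using generator by blast
  then obtain c' where c': "c' \<in> carrier M" "\<Delta> = c \<otimes> c'" by (auto simp: left_divisors_def factor_def)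
  have "s \<otimes> \<Delta> = s \<otimes> (c \<otimes> c')" using c'(2) by simp
  also have "\<dots> = (s \<otimes> c) \<otimes> c'" using c(1) c'(1) generator(2) by (simp add: m_assoc)
  also have "\<dots> = \<Delta> \<otimes> c'" using c(2) by simp
  finally show ?case using c' by blast
next
  case one
  then show ?case using Garside_element_closed by (intro bexI[of _ \<one>]) auto
next
  case (mult a b)
  then obtain a' b' where "a' \<in> carrier M" "a \<otimes> \<Delta> = \<Delta> \<otimes> a'" "b' \<in> carrier M" "b \<otimes> \<Delta> = \<Delta> \<otimes> b'" by blast
  then have "a \<otimes> b \<otimes> \<Delta> = \<Delta> \<otimes> (a' \<otimes> b')"
    using mult(1,2) Garside_element_closed by (metis m_assoc)
  then show ?case using \<open>a' \<in> carrier M\<close> \<open>b' \<in> carrier M\<close> by blast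
qed

lemma Delta_conjugates_left:
  assumes "m \<in> carrier M"
  shows "\<exists>m'\<in>carrier M. \<Delta> \<otimes> m = m' \<otimes> \<Delta>"
  using simple_divisors_generate assms
proof (induction rule: generates_monoid_induct)
  case (generator s)
  then obtain c where c: "c \<in> carrier M" "\<Delta> = c \<otimes> s"
    using left_divisors_eq_right_divisors right_divisors_iff by metis
  then have "c \<in> right_divisors M \<Delta>"
    unfolding left_divisors_eq_right_divisors[symmetric] left_divisors_def factor_def
    using generator by blast
  then obtain c' where c': "c' \<in> carrier M" "\<Delta> = c' \<otimes> c" by (auto simp: right_divisors_iff)
  have "\<Delta> \<otimes> s = (c' \<otimes> c) \<otimes> s" using c'(2) by simp
  also have "\<dots> = c' \<otimes> (c \<otimes> s)" using c(1) c'(1) generator(2) by (simp add: m_assoc)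
  also have "\<dots> = c' \<otimes> \<Delta>" using c(2) by simp
  finally show ?case using c' by blast
next
  case one
  then show ?case using Garside_element_closed by (intro bexI[of _ \<one>]) auto
next
  case (mult a b)
  then obtain a' b' where "a' \<in> carrier M" "\<Delta> \<otimes> a = a' \<otimes> \<Delta>" "b' \<in> carrier M" "\<Delta> \<otimes> b = b' \<otimes> \<Delta>" by blast
  then have "\<Delta> \<otimes> (a \<otimes> b) = (a' \<otimes> b') \<otimes> \<Delta>"
    using mult(1,2) Garside_element_closed by (metis m_assoc)
  then show ?case using \<open>a' \<in> carrier M\<close> \<open>b' \<in> carrier M\<close> by blast
qed

lemma Delta_pow_conjugates_right:
  assumes "m \<in> carrier M"
  shows "\<exists>m'\<in>carrier M. m \<otimes> \<Delta> [^] (n::nat) = \<Delta> [^] n \<otimes> m'"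
  using assms
proof (induction n arbitrary: m)
  case 0
  then show ?case by auto
next
  case (Suc n)
  obtain m1 where m1: "m1 \<in> carrier M" "m \<otimes> \<Delta> [^] n = \<Delta> [^] n \<otimes> m1" using Suc by blast
  obtain m2 where m2: "m2 \<in> carrier M" "m1 \<otimes> \<Delta> = \<Delta> \<otimes> m2" using Delta_conjugates_right m1 by blast
  have "m \<otimes> \<Delta> [^] Suc n = (m \<otimes> \<Delta> [^] n) \<otimes> \<Delta>"
    using Suc.prems Garside_element_closed by (simp add: m_assoc)
  also have "\<dots> = \<Delta> [^] n \<otimes> (m1 \<otimes> \<Delta>)" using m1 Garside_element_closed by (simp add: m_assoc)
  also have "\<dots> = \<Delta> [^] Suc n \<otimes> m2" using m2 Garside_element_closed by (simp add: m_assoc)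
  finally show ?case using m2 by blast
qed

lemma divides_Delta_pow:
  assumes "m \<in> carrier M"
  shows "\<exists>n::nat. \<exists>c\<in>carrier M. \<Delta> [^] n = m \<otimes> c"
  using simple_divisors_generate assms
proof (induction rule: generates_monoid_induct)
  case (generator s)
  then obtain c where "c \<in> carrier M" "\<Delta> = s \<otimes> c" by (auto simp: left_divisors_def factor_def)
  then show ?case using Garside_element_closed by (intro exI[of _ "1::nat"]) auto
next
  case one
  show ?case by (intro exI[of _ "0::nat"]) auto
next
  case (mult a b)
  then obtain n k :: nat and c d where c: "c \<in> carrier M" "\<Delta> [^] n = a \<otimes> c"
    and d: "d \<in> carrier M" "\<Delta> [^] k = b \<otimes> d" by blast
  obtain c' where c': "c' \<in> carrier M" "c \<otimes> \<Delta> [^] k = \<Delta> [^] k \<otimes> c'"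
    using Delta_pow_conjugates_right c by blast
  have "\<Delta> [^] (n + k) = (a \<otimes> c) \<otimes> \<Delta> [^] k"
    using c(2) nat_pow_mult[OF Garside_element_closed, of n k] by simp
  also have "\<dots> = a \<otimes> (\<Delta> [^] k \<otimes> c')"
    using mult(1) c c' Garside_element_closed by (simp add: m_assoc)
  also have "\<dots> = (a \<otimes> b) \<otimes> (d \<otimes> c')" using mult(1,2) c' d by (simp add: m_assoc)
  finally show ?case using d(1) c'(1) by blast
qed

text \<open>For joins, two fractions are moved into the monoid by a left translation: multiply both by a common
  left multiple of their denominators. There the least common multiple is available, and it
  is least among all common upper bounds in the group, because these are moved into the monoid too.\<close>

lemma garside_order_group_of_fractions:
  fixes G :: "('g, 'n) monoid_scheme"
  assumes frac: "group_of_fractions M G \<iota>" and nontriv: "\<Delta> \<noteq> \<one>"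
  shows "garside_order G (\<iota> ` carrier M) (\<iota> \<Delta>)"
proof -
  have Ggroup: "group G" and hom: "\<iota> \<in> hom M G" and inj: "inj_on \<iota> (carrier M)"
    and fraction: "\<And>g. g \<in> carrier G \<Longrightarrow>
      \<exists>a\<in>carrier M. \<exists>b\<in>carrier M. g = inv\<^bsub>G\<^esub> (\<iota> a) \<otimes>\<^bsub>G\<^esub> \<iota> b"
    using frac by (auto simp: group_of_fractions_def mon_def)
  interpret G: group G by (rule Ggroup)
  have \<iota>c [simp]: "\<iota> m \<in> carrier G" if "m \<in> carrier M" for m using hom that by (auto simp: hom_def)
  have \<iota>m: "\<iota> (a \<otimes> b) = \<iota> a \<otimes>\<^bsub>G\<^esub> \<iota> b" if "a \<in> carrier M" "b \<in> carrier M" for a b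
    using hom that by (auto simp: hom_def)
  have \<iota>1: "\<iota> \<one> = \<one>\<^bsub>G\<^esub>"
    using \<iota>m[of \<one> \<one>] \<iota>c[of \<one>] G.r_cancel_one[of "\<iota> \<one>" "\<iota> \<one>"] by simp
  have \<iota>pow: "\<iota> (\<Delta> [^] n) = \<iota> \<Delta> [^]\<^bsub>G\<^esub> n" for n :: nat
    by (induction n) (simp_all add: \<iota>1 \<iota>m Garside_element_closed)
  have inj_eq: "a = b" if "\<iota> a = \<iota> b" "a \<in> carrier M" "b \<in> carrier M" for a b
    using inj that by (auto simp: inj_on_def)
  have cancel: "x \<otimes>\<^bsub>G\<^esub> (inv\<^bsub>G\<^esub> x \<otimes>\<^bsub>G\<^esub> y) = y" "inv\<^bsub>G\<^esub> x \<otimes>\<^bsub>G\<^esub> (x \<otimes>\<^bsub>G\<^esub> y) = y"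
    if "x \<in> carrier G" "y \<in> carrier G" for x y
    using that by (simp_all add: G.m_assoc[symmetric])
  show ?thesis
  proof (intro garside_order.intro garside_order_axioms.intro Ggroup)
    show "\<iota> ` carrier M \<subseteq> carrier G" by auto
    show "\<one>\<^bsub>G\<^esub> \<in> \<iota> ` carrier M" using \<iota>1 by (metis imageI one_closed)
    show "p \<otimes>\<^bsub>G\<^esub> q \<in> \<iota> ` carrier M" if "p \<in> \<iota> ` carrier M" "q \<in> \<iota> ` carrier M" for p q
      using that by (auto simp: \<iota>m[symmetric])
    show "p = \<one>\<^bsub>G\<^esub>" if p: "p \<in> \<iota> ` carrier M" "inv\<^bsub>G\<^esub> p \<in> \<iota> ` carrier M" for p
    proof -
      obtain a where a: "a \<in> carrier M" "p = \<iota> a" using p by blast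
      obtain b where b: "b \<in> carrier M" "inv\<^bsub>G\<^esub> p = \<iota> b" using p by blast
      have "\<iota> (a \<otimes> b) = \<one>\<^bsub>G\<^esub>"
        unfolding \<iota>m[OF a(1) b(1)] b(2)[symmetric] a(2) using a by simp
      then have "a \<otimes> b = \<one>" using inj_eq[of "a \<otimes> b" \<one>] \<iota>1 a b by simp
      then show ?thesis using no_units a b \<iota>1 by blast
    qed
    show "\<iota> \<Delta> \<in> \<iota> ` carrier M" using Garside_element_closed by blast
    show "\<iota> \<Delta> \<noteq> \<one>\<^bsub>G\<^esub>" using inj_eq[of \<Delta> \<one>] \<iota>1 nontriv Garside_element_closed by auto
    show "inv\<^bsub>G\<^esub> (\<iota> \<Delta>) \<otimes>\<^bsub>G\<^esub> p \<otimes>\<^bsub>G\<^esub> \<iota> \<Delta> \<in> \<iota> ` carrier M" if p: "p \<in> \<iota> ` carrier M" for p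
    proof -
      obtain m where m: "m \<in> carrier M" "p = \<iota> m" using p by blast
      obtain m' where m': "m' \<in> carrier M" "m \<otimes> \<Delta> = \<Delta> \<otimes> m'" using Delta_conjugates_right m by blast
      have "p \<otimes>\<^bsub>G\<^esub> \<iota> \<Delta> = \<iota> \<Delta> \<otimes>\<^bsub>G\<^esub> \<iota> m'"
        using m m' \<iota>m Garside_element_closed by metis
      then have "inv\<^bsub>G\<^esub> (\<iota> \<Delta>) \<otimes>\<^bsub>G\<^esub> p \<otimes>\<^bsub>G\<^esub> \<iota> \<Delta> = \<iota> m'"
        using m m' Garside_element_closed by (simp add: G.m_assoc cancel)
      then show ?thesis using m' by simp
    qed
    show "\<iota> \<Delta> \<otimes>\<^bsub>G\<^esub> p \<otimes>\<^bsub>G\<^esub> inv\<^bsub>G\<^esub> (\<iota> \<Delta>) \<in> \<iota> ` carrier M" if p: "p \<in> \<iota> ` carrier M" for p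
    proof -
      obtain m where m: "m \<in> carrier M" "p = \<iota> m" using p by blast
      obtain m' where m': "m' \<in> carrier M" "\<Delta> \<otimes> m = m' \<otimes> \<Delta>" using Delta_conjugates_left m by blast
      have "\<iota> \<Delta> \<otimes>\<^bsub>G\<^esub> p = \<iota> m' \<otimes>\<^bsub>G\<^esub> \<iota> \<Delta>"
        using m m' \<iota>m Garside_element_closed by metis
      then have "\<iota> \<Delta> \<otimes>\<^bsub>G\<^esub> p \<otimes>\<^bsub>G\<^esub> inv\<^bsub>G\<^esub> (\<iota> \<Delta>) = \<iota> m'"
        using m m' Garside_element_closed by (simp add: G.m_assoc)
      then show ?thesis using m' by simp
    qed
    show "\<exists>n::nat. inv\<^bsub>G\<^esub> g \<otimes>\<^bsub>G\<^esub> \<iota> \<Delta> [^]\<^bsub>G\<^esub> n \<in> \<iota> ` carrier M" if g: "g \<in> carrier G" for g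
    proof -
      obtain a b where ab: "a \<in> carrier M" "b \<in> carrier M" "g = inv\<^bsub>G\<^esub> (\<iota> a) \<otimes>\<^bsub>G\<^esub> \<iota> b"
        using fraction g by blast
      obtain n :: nat and c where c: "c \<in> carrier M" "\<Delta> [^] n = b \<otimes> c" using divides_Delta_pow ab by blast
      obtain a' where a': "a' \<in> carrier M" "a \<otimes> \<Delta> [^] n = \<Delta> [^] n \<otimes> a'"
        using Delta_pow_conjugates_right ab by blast
      have "\<iota> a \<otimes>\<^bsub>G\<^esub> \<iota> \<Delta> [^]\<^bsub>G\<^esub> n = \<iota> (a \<otimes> \<Delta> [^] n)"
        using ab \<iota>m \<iota>pow Garside_element_closed by simp
      also have "\<dots> = \<iota> (b \<otimes> (c \<otimes> a'))" using a'(2) c ab a'(1) by (simp add: m_assoc)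
      also have "\<dots> = \<iota> b \<otimes>\<^bsub>G\<^esub> \<iota> (c \<otimes> a')" using ab c a' by (simp add: \<iota>m)
      finally have "\<iota> a \<otimes>\<^bsub>G\<^esub> \<iota> \<Delta> [^]\<^bsub>G\<^esub> n = \<iota> b \<otimes>\<^bsub>G\<^esub> \<iota> (c \<otimes> a')" .
      then have "inv\<^bsub>G\<^esub> g \<otimes>\<^bsub>G\<^esub> \<iota> \<Delta> [^]\<^bsub>G\<^esub> n = \<iota> (c \<otimes> a')"
        using ab c a' Garside_element_closed by (simp add: G.inv_mult_group G.m_assoc cancel)
      then show ?thesis using c a' by auto
    qed
    show "\<exists>z\<in>carrier G. inv\<^bsub>G\<^esub> x \<otimes>\<^bsub>G\<^esub> z \<in> \<iota> ` carrier M \<and> inv\<^bsub>G\<^esub> y \<otimes>\<^bsub>G\<^esub> z \<in> \<iota> ` carrier M \<and>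
        (\<forall>w\<in>carrier G. inv\<^bsub>G\<^esub> x \<otimes>\<^bsub>G\<^esub> w \<in> \<iota> ` carrier M \<longrightarrow> inv\<^bsub>G\<^esub> y \<otimes>\<^bsub>G\<^esub> w \<in> \<iota> ` carrier M \<longrightarrow>
          inv\<^bsub>G\<^esub> z \<otimes>\<^bsub>G\<^esub> w \<in> \<iota> ` carrier M)"
      if xy: "x \<in> carrier G" "y \<in> carrier G" for x y
    proof -
      obtain a b where ab: "a \<in> carrier M" "b \<in> carrier M" "x = inv\<^bsub>G\<^esub> (\<iota> a) \<otimes>\<^bsub>G\<^esub> \<iota> b"
        using fraction xy by blast
      obtain c d where cd: "c \<in> carrier M" "d \<in> carrier M" "y = inv\<^bsub>G\<^esub> (\<iota> c) \<otimes>\<^bsub>G\<^esub> \<iota> d"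
        using fraction xy by blast
      obtain m where "m \<in> carrier M" "m lcmof\<^bsub>opposite M\<^esub> a c" using right_lcm_ex ab cd by blast
      then obtain u v where uv: "u \<in> carrier M" "v \<in> carrier M" "m = u \<otimes> a" "m = v \<otimes> c"
        by (auto simp: islcm_def factor_def opposite_def)
      define t where "t = \<iota> m"
      have tc: "t \<in> carrier G" using uv ab by (simp add: t_def)
      have tx: "t \<otimes>\<^bsub>G\<^esub> x = \<iota> (u \<otimes> b)"
        unfolding t_def uv(3) ab(3) using uv(1,2) ab(1,2) by (simp add: \<iota>m G.m_assoc cancel)
      have ty: "t \<otimes>\<^bsub>G\<^esub> y = \<iota> (v \<otimes> d)"
        unfolding t_def uv(4) cd(3) using uv(1,2) cd(1,2) by (simp add: \<iota>m G.m_assoc cancel)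
      obtain l where l: "l \<in> carrier M" "l lcmof (u \<otimes> b) (v \<otimes> d)"
        using left_lcm_ex[of "u \<otimes> b" "v \<otimes> d"] uv ab cd by auto
      obtain e f where e: "e \<in> carrier M" "l = (u \<otimes> b) \<otimes> e" and f: "f \<in> carrier M" "l = (v \<otimes> d) \<otimes> f"
        using l(2) by (auto simp: islcm_def factor_def)
      define z where "z = inv\<^bsub>G\<^esub> t \<otimes>\<^bsub>G\<^esub> \<iota> l"
      have zc: "z \<in> carrier G" using tc l by (simp add: z_def)
      have tz: "t \<otimes>\<^bsub>G\<^esub> z = \<iota> l" using tc l by (simp add: z_def cancel)
      have move: "inv\<^bsub>G\<^esub> p \<otimes>\<^bsub>G\<^esub> w = inv\<^bsub>G\<^esub> (t \<otimes>\<^bsub>G\<^esub> p) \<otimes>\<^bsub>G\<^esub> (t \<otimes>\<^bsub>G\<^esub> w)"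
        if "p \<in> carrier G" "w \<in> carrier G" for p w
        using that tc by (simp add: G.inv_mult_group G.m_assoc cancel)
      have "inv\<^bsub>G\<^esub> x \<otimes>\<^bsub>G\<^esub> z = \<iota> e"
        unfolding move[OF xy(1) zc] tx tz e(2) using uv ab e by (simp add: \<iota>m[of "u \<otimes> b"] cancel)
      moreover have "inv\<^bsub>G\<^esub> y \<otimes>\<^bsub>G\<^esub> z = \<iota> f"
        unfolding move[OF xy(2) zc] ty tz f(2) using uv cd f by (simp add: \<iota>m[of "v \<otimes> d"] cancel)
      moreover have "inv\<^bsub>G\<^esub> z \<otimes>\<^bsub>G\<^esub> w \<in> \<iota> ` carrier M"
        if w: "w \<in> carrier G" "inv\<^bsub>G\<^esub> x \<otimes>\<^bsub>G\<^esub> w \<in> \<iota> ` carrier M" "inv\<^bsub>G\<^esub> y \<otimes>\<^bsub>G\<^esub> w \<in> \<iota> ` carrier M" for w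
      proof -
        obtain g where g: "g \<in> carrier M" "inv\<^bsub>G\<^esub> x \<otimes>\<^bsub>G\<^esub> w = \<iota> g" using w by blast
        obtain h where h: "h \<in> carrier M" "inv\<^bsub>G\<^esub> y \<otimes>\<^bsub>G\<^esub> w = \<iota> h" using w by blast
        have "t \<otimes>\<^bsub>G\<^esub> w = (t \<otimes>\<^bsub>G\<^esub> x) \<otimes>\<^bsub>G\<^esub> \<iota> g"
          unfolding g(2)[symmetric] using tc xy w by (simp add: G.m_assoc cancel)
        then have 1: "t \<otimes>\<^bsub>G\<^esub> w = \<iota> ((u \<otimes> b) \<otimes> g)" unfolding tx using uv ab g by (simp add: \<iota>m[of "u \<otimes> b"])
        have "t \<otimes>\<^bsub>G\<^esub> w = (t \<otimes>\<^bsub>G\<^esub> y) \<otimes>\<^bsub>G\<^esub> \<iota> h"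
          unfolding h(2)[symmetric] using tc xy w by (simp add: G.m_assoc cancel)
        then have 2: "t \<otimes>\<^bsub>G\<^esub> w = \<iota> ((v \<otimes> d) \<otimes> h)" unfolding ty using uv cd h by (simp add: \<iota>m[of "v \<otimes> d"])
        have "(u \<otimes> b) \<otimes> g = (v \<otimes> d) \<otimes> h" using 1 2 uv ab cd g h by (intro inj_eq) auto
        then have "l divides ((u \<otimes> b) \<otimes> g)"
          using l(2) uv ab g h unfolding islcm_def factor_def by (metis m_closed)
        then obtain k where k: "k \<in> carrier M" "(u \<otimes> b) \<otimes> g = l \<otimes> k" by (auto simp: factor_def)
        have "inv\<^bsub>G\<^esub> z \<otimes>\<^bsub>G\<^esub> w = \<iota> k"
          unfolding move[OF zc w(1)] tz 1 k(2) using l k by (simp add: \<iota>m cancel)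
        then show ?thesis using k by simp
      qed
      ultimately show ?thesis using zc e f by blast
    qed
    show "finite {p \<in> \<iota> ` carrier M. inv\<^bsub>G\<^esub> p \<otimes>\<^bsub>G\<^esub> \<iota> \<Delta> [^]\<^bsub>G\<^esub> n \<in> \<iota> ` carrier M}" for n :: nat
    proof -
      have "{p \<in> \<iota> ` carrier M. inv\<^bsub>G\<^esub> p \<otimes>\<^bsub>G\<^esub> \<iota> \<Delta> [^]\<^bsub>G\<^esub> n \<in> \<iota> ` carrier M}
          \<subseteq> \<iota> ` {p \<in> carrier M. \<exists>c\<in>carrier M. \<Delta> [^] n = p \<otimes> c}"
      proof
        fix p assume "p \<in> {p \<in> \<iota> ` carrier M. inv\<^bsub>G\<^esub> p \<otimes>\<^bsub>G\<^esub> \<iota> \<Delta> [^]\<^bsub>G\<^esub> n \<in> \<iota> ` carrier M}"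
        then obtain a c where a: "a \<in> carrier M" "p = \<iota> a"
          and c: "c \<in> carrier M" "inv\<^bsub>G\<^esub> p \<otimes>\<^bsub>G\<^esub> \<iota> \<Delta> [^]\<^bsub>G\<^esub> n = \<iota> c" by blast
        have "\<iota> (\<Delta> [^] n) = \<iota> a \<otimes>\<^bsub>G\<^esub> \<iota> c"
          unfolding c(2)[symmetric] a(2) \<iota>pow using a Garside_element_closed by (simp add: cancel)
        then have "\<Delta> [^] n = a \<otimes> c"
          using a c Garside_element_closed by (intro inj_eq) (auto simp: \<iota>m)
        then show "p \<in> \<iota> ` {p \<in> carrier M. \<exists>c\<in>carrier M. \<Delta> [^] n = p \<otimes> c}" using a c by blast
      qed
      then show ?thesis
        using finite_divisors[of "\<Delta> [^] n"] Garside_element_closed finite_subset by blast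
    qed
  qed
qed

lemma trivial_group_of_fractions:
  fixes G :: "('g, 'n) monoid_scheme"
  assumes frac: "group_of_fractions M G \<iota>" and triv: "\<Delta> = \<one>"
  shows "carrier G = {\<one>\<^bsub>G\<^esub>}"
proof -
  interpret G: group G using frac by (simp add: group_of_fractions_def)
  have "left_divisors M \<Delta> \<subseteq> {\<one>}"
  proof
    fix a assume "a \<in> left_divisors M \<Delta>"
    then obtain c where "a \<in> carrier M" "c \<in> carrier M" "\<one> = a \<otimes> c"
      unfolding left_divisors_def factor_def triv by blast
    then show "a \<in> {\<one>}" using no_units[of a c] by simp
  qed
  have trivM: "m = \<one>" if "m \<in> carrier M" for m
    using simple_divisors_generate that
    by (induction rule: generates_monoid_induct) (use \<open>left_divisors M \<Delta> \<subseteq> {\<one>}\<close> in auto)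
  have "g = \<one>\<^bsub>G\<^esub>" if g: "g \<in> carrier G" for g
  proof -
    obtain a b where ab: "a \<in> carrier M" "b \<in> carrier M" "g = inv\<^bsub>G\<^esub> (\<iota> a) \<otimes>\<^bsub>G\<^esub> \<iota> b"
      using frac g by (auto simp: group_of_fractions_def)
    have "\<iota> \<one> \<in> carrier G" using frac by (auto simp: group_of_fractions_def mon_def hom_def)
    then show ?thesis using ab trivM[OF ab(1)] trivM[OF ab(2)] by simp
  qed
  then show ?thesis using G.one_closed by blast
qed

end

theorem corollary6p13:
  fixes M :: "('a, 'm) monoid_scheme" and \<Delta> :: 'a
    and G :: "('g, 'n) monoid_scheme" and \<iota> :: "'a \<Rightarrow> 'g" and H :: "'g set"
  assumes "Garside_monoid M \<Delta>"
    and "group_of_fractions M G \<iota>"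
    and "tame M \<Delta>"
    and "subgroup H G"
    and "solvable (G\<lparr>carrier := H\<rparr>)"
  shows "virtually (\<lambda>A. comm_group A \<and> finitely_generated A) (G\<lparr>carrier := H\<rparr>)"
proof (cases "\<Delta> = \<one>\<^bsub>M\<^esub>")
  case False
  interpret garside_order G "\<iota> ` carrier M" "\<iota> \<Delta>"
    using Garside_monoid.garside_order_group_of_fractions[OF assms(1,2) False] .
  show ?thesis using solvable_imp_virtually_fg_abelian[OF assms(4,5)] .
next
  case True
  interpret group G using assms(2) by (simp add: group_of_fractions_def)
  have "carrier G = {\<one>\<^bsub>G\<^esub>}"
    using Garside_monoid.trivial_group_of_fractions[OF assms(1,2) True] .
  then have H: "H = {\<one>\<^bsub>G\<^esub>}"
    using subgroup.subset[OF assms(4)] subgroup.one_closed[OF assms(4)] by blast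
  interpret H: group "G\<lparr>carrier := H\<rparr>" using subgroup.subgroup_is_group[OF assms(4) is_group] .
  have "subgroup H (G\<lparr>carrier := H\<rparr>)" using H.subgroup_self by simp
  moreover have "finite (rcosets\<^bsub>G\<lparr>carrier := H\<rparr>\<^esub> H)" by (simp add: RCOSETS_def H)
  moreover have "comm_group (G\<lparr>carrier := H\<rparr>)" by (rule H.group_comm_groupI) (simp add: H)
  moreover have "generate (G\<lparr>carrier := H\<rparr>) {} = H" using H.generate_empty by (simp add: H)
  then have "finitely_generated (G\<lparr>carrier := H\<rparr>)"
    unfolding finitely_generated_def by (intro exI[of _ "{}"]) simp
  ultimately show ?thesis unfolding virtually_def by auto
qed

end
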